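(* Let $\{\varphi_r\}_{0<r<1}$ be an arbitrary approximate identity on $\mathbb{T}$ (not necessarily non-negative), let $1\le p<\infty$, let $q=p/(p-1)$ be the conjugate index of $p$ ($q=\infty$ if $p=1$), let $\rho(r)=\|\varphi_r\|_q^{-p}$, and let $c>0$ be a constant. Then for every $f\in L^p(\mathbb{T})$, $$\lim_{\substack{r\to1\\|\theta|<c\rho(r)}}\Phi_r(x+\theta,f)=f(x)\quad\text{for almost every }x\in\mathbb{T}.$$
   Context: $\mathbb{T}=\mathbb{R}/2\pi\mathbb{Z}$ is the unit circle, with points represented by $[-\pi,\pi]$ (endpoints identified), Lebesgue measure $dt$, and $\|\cdot\|_q$ the norm of $L^q(\mathbb{T})$. An approximate identity is a family $\{\varphi_r\}_{0<r<1}\subset L^\infty(\mathbb{T})$ such that: ($\Phi1$) $\int_{\mathbb{T}}\varphi_r(t)\,dt\to1$ as $r\to1$; ($\Phi2$) $\varphi_r^*(x):=\sup_{|x|\le|t|\le\pi}|\varphi_r(t)|\to0$ as $r\to1$ for every $0<|x|\le\pi$; ($\Phi3$) $C_\varphi:=\sup_{0<r<1}\|\varphi_r^*\|_1<\infty$. $\Phi_r(x,f)=\int_{\mathbb{T}}\varphi_r(x-t)f(t)\,dt$. The limit means $\lim_{r\to1}\sup_{|\theta|<c\rho(r)}|\Phi_r(x+\theta,f)-f(x)|=0$. *)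

theory Defs
  imports "HOL-Analysis.Analysis" "HOL-Library.Periodic_Fun" "HOL-Probability.Essential_Supremum"
begin

text \<open>
  Functions on the circle are \<open>2\<pi>\<close>-periodic functions on the real line. Norms and integrals
  are taken over the fundamental interval \<open>[-\<pi>, \<pi>]\<close>, whose two endpoints form a null set.
  The scalar type is of class \<open>{real_normed_field, euclidean_space}\<close>, so that it may be
  instantiated with either \<^typ>\<open>real\<close> or \<^typ>\<open>complex\<close>.
\<close>

abbreviation circle :: "real measure" where
  "circle \<equiv> lebesgue_on {-pi..pi}"

definition circle_norm ::
    "ennreal \<Rightarrow> (real \<Rightarrow> 'a::{real_normed_field, euclidean_space}) \<Rightarrow> ennreal" where
  "circle_norm q g =
     (if q = \<infinity> then esssup circle (\<lambda>t. ennreal (norm (g t)))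
      else let I = (\<integral>\<^sup>+ t. ennreal (norm (g t) powr enn2real q) \<partial>circle)
           in if I = \<infinity> then \<infinity> else ennreal (enn2real I powr (1 / enn2real q)))"

definition circle_Lp ::
    "ennreal \<Rightarrow> (real \<Rightarrow> 'a::{real_normed_field, euclidean_space}) set" where
  "circle_Lp q = {g. periodic_fun_simple g (2 * pi) \<and> g \<in> borel_measurable circle
                     \<and> circle_norm q g < \<infinity>}"

definition conj_exponent :: "real \<Rightarrow> ennreal" where
  "conj_exponent p = (if p = 1 then \<infinity> else ennreal (p / (p - 1)))"

text \<open>
  The supremum of the modulus of an element of \<open>L\<^sup>\<infinity>\<close> is the essential supremum. It is at most
  the pointwise supremum of any representative, so kernels that satisfy the conditions below
  with pointwise suprema are included. In \<^typ>\<open>ennreal\<close>, the essential supremum over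
  a null set (the case \<open>\<bar>x\<bar> = \<pi>\<close>) is 0.
\<close>

definition radial_majorant ::
    "(real \<Rightarrow> 'a::{real_normed_field, euclidean_space}) \<Rightarrow> real \<Rightarrow> ennreal" where
  "radial_majorant g x =
     esssup (lebesgue_on {t. \<bar>x\<bar> \<le> \<bar>t\<bar> \<and> \<bar>t\<bar> \<le> pi}) (\<lambda>t. ennreal (norm (g t)))"

definition approximate_identity ::
    "(real \<Rightarrow> real \<Rightarrow> 'a::{real_normed_field, euclidean_space}) \<Rightarrow> bool" where
  "approximate_identity \<phi> \<longleftrightarrow>
     (\<forall>r\<in>{0<..<1}. \<phi> r \<in> circle_Lp \<infinity>) \<and>
     ((\<lambda>r. LINT t|circle. \<phi> r t) \<longlongrightarrow> 1) (at_left 1) \<and>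
     (\<forall>x. 0 < \<bar>x\<bar> \<and> \<bar>x\<bar> \<le> pi \<longrightarrow> ((\<lambda>r. radial_majorant (\<phi> r) x) \<longlongrightarrow> 0) (at_left 1)) \<and>
     (SUP r\<in>{0<..<1}. \<integral>\<^sup>+ x. radial_majorant (\<phi> r) x \<partial>circle) < \<infinity>"

definition kernel_op ::
    "(real \<Rightarrow> real \<Rightarrow> 'a::{real_normed_field, euclidean_space}) \<Rightarrow> real \<Rightarrow> real \<Rightarrow> (real \<Rightarrow> 'a) \<Rightarrow> 'a"
  where "kernel_op \<phi> r x f = (LINT t|circle. \<phi> r (x - t) * f t)"

text \<open>
  If \<open>\<phi> r\<close> vanishes almost everywhere, the value below is 0 rather than \<open>\<infinity>\<close>. For an approximate
  identity this cannot occur for \<open>r\<close> close to 1, because the integral of \<open>\<phi> r\<close> tends to 1.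
\<close>

definition approach_rate ::
    "(real \<Rightarrow> real \<Rightarrow> 'a::{real_normed_field, euclidean_space}) \<Rightarrow> real \<Rightarrow> real \<Rightarrow> real" where
  "approach_rate \<phi> p r = enn2real (circle_norm (conj_exponent p) (\<phi> r)) powr (- p)"

end

theory Submission
  imports Defs
begin

text \<open>
  The convergence holds at every point \<open>x\<close> that is a Lebesgue point of \<open>f\<close> both for the
  exponent \<open>p\<close> and for the exponent \<open>1\<close>.  After a rotation of the circle, and up to the
  term \<open>f x * (\<integral> \<phi> r - 1)\<close>, which tends to \<open>0\<close>, the difference
  \<open>kernel_op \<phi> r (x + \<theta>) f - f x\<close> is at most the integral over \<open>s\<close> of
  \<open>\<bar>\<phi> r (\<theta> - s)\<bar> * G s\<close> with \<open>G s = \<bar>f (x + s) - f x\<bar>\<close>.  Write \<open>N\<close> for the norm of \<open>\<phi> r\<close>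
  with the conjugate exponent, and let \<open>\<bar>\<theta>\<bar> < a = c / N\<^sup>p\<close>.  The circle is cut into three parts.

  For \<open>\<bar>s\<bar> \<le> 2 * a\<close>, Hoelder's inequality bounds the integral by \<open>N\<close> times the \<open>p\<close>-norm of
  \<open>G\<close> on an interval of length \<open>4 * a\<close>.  The Lebesgue point property makes the \<open>p\<close>-th power of
  this norm \<open>o(a) = o(1 / N\<^sup>p)\<close>, so the product tends to \<open>0\<close>: this is where the exponent in the
  approach rate comes from.  For \<open>2 * a < \<bar>s\<bar> \<le> \<delta>\<close> the shift \<open>\<theta>\<close> is harmless, since
  \<open>\<bar>\<theta> - s\<bar> \<ge> \<bar>s\<bar> / 2\<close>; the kernel is below its radial majorant at \<open>s / 2\<close>, which is
  decreasing with bounded integral, and summation over dyadic annuli gives a small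
  multiple of that integral (\<open>annuli_estimate\<close>).  For \<open>\<bar>s\<bar> > \<delta>\<close> the majorant itself tends to
  \<open>0\<close>.  The cut requires \<open>a \<rightarrow> 0\<close>; this holds because the mass of an approximate identity, which
  tends to \<open>1\<close>, concentrates on arbitrarily short arcs around \<open>0\<close> (\<open>approach_rate_tendsto_0\<close>).

  That almost every point is a Lebesgue point follows from a density statement
  (\<open>zero_density\<close>), a consequence of the Vitali covering lemma.
\<close>

section \<open>Lebesgue points\<close>

text \<open>
  The zero set \<open>A\<close> lies in an open set \<open>U\<close> over which the integral is
  as small as desired.  If the averages at \<open>x\<close> exceed \<open>\<epsilon>\<close> for arbitrarily small radii, then one
  such ball lies in \<open>U\<close>.  A disjoint selection from these balls covers all such \<open>x\<close> after
  enlargement by the factor \<open>5\<close>, and its total measure is at most the integral over \<open>U\<close> divided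
  by \<open>\<epsilon>\<close>.
\<close>

lemma zero_density:
  fixes g :: "'b::euclidean_space \<Rightarrow> ennreal"
  assumes g [measurable]: "g \<in> borel_measurable lebesgue"
    and fin: "(\<integral>\<^sup>+ y. g y \<partial>lebesgue) < \<infinity>"
    and A [measurable]: "A \<in> sets lebesgue"
    and zero: "\<And>y. y \<in> A \<Longrightarrow> g y = 0"
  shows "AE x in lebesgue. x \<in> A \<longrightarrow>
           (\<forall>\<epsilon>>0. \<exists>d>0. \<forall>h. 0 < h \<and> h \<le> d \<longrightarrow>
              (\<integral>\<^sup>+ y\<in>cball x h. g y \<partial>lebesgue) \<le> ennreal \<epsilon> * emeasure lebesgue (cball x h))"
proof -
  define bad where "bad \<epsilon> = {x \<in> A. \<forall>d>0. \<exists>h. 0 < h \<and> h \<le> d \<and>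
      ennreal \<epsilon> * emeasure lebesgue (cball x h) < (\<integral>\<^sup>+ y\<in>cball x h. g y \<partial>lebesgue)}" for \<epsilon>
  have cb [measurable]: "cball x h \<in> sets lebesgue" for x :: 'b and h
    by (simp add: borel_closed)
  have small_open: "\<exists>U. open U \<and> A \<subseteq> U \<and> (\<integral>\<^sup>+ y\<in>U. g y \<partial>lebesgue) < ennreal e" if "e > 0" for e
  proof -
    have "\<exists>T. open T \<and> A \<subseteq> T \<and> T - A \<in> lmeasurable \<and> emeasure lebesgue (T - A) < ennreal ((1/2)^n)" for n :: nat
      using sets_lebesgue_outer_open[OF A, of "(1/2)^n"] by (metis zero_less_power half_gt_zero zero_less_one)
    then obtain T where T: "\<And>n::nat. open (T n)" "\<And>n. A \<subseteq> T n" "\<And>n. T n - A \<in> lmeasurable"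
        "\<And>n. emeasure lebesgue (T n - A) < ennreal ((1/2)^n)"
      by metis
    \<comment> \<open>Intersections make the open sets decrease to a set that differs from \<open>A\<close> by a null set.\<close>
    define V where "V n = (\<Inter>k\<le>n. T k)" for n
    have oV: "open (V n)" and AV: "A \<subseteq> V n" for n
      using T by (auto simp: V_def)
    have [measurable]: "V n \<in> sets lebesgue" for n
      using oV[of n] by (simp add: borel_open)
    have dec: "decseq (\<lambda>n. V n - A)"
      unfolding decseq_def V_def by (auto intro: order_trans)
    have le: "emeasure lebesgue (\<Inter>n. V n - A) \<le> ennreal ((1/2)^n)" for n
    proof -
      have "emeasure lebesgue (\<Inter>n. V n - A) \<le> emeasure lebesgue (T n - A)"
        using T(3)[of n] by (intro emeasure_mono) (auto simp: V_def)
      then show ?thesis using T(4)[of n] by simp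
    qed
    have "emeasure lebesgue (\<Inter>n. V n - A) \<le> 0"
    proof (rule LIMSEQ_le_const)
      have "(\<lambda>n. (1/2::real)^n) \<longlonglongrightarrow> 0" by (simp add: LIMSEQ_power_zero)
      then show "(\<lambda>n. ennreal ((1/2)^n)) \<longlonglongrightarrow> 0"
        using tendsto_ennrealI ennreal_0 by metis
    qed (use le in auto)
    then have null: "(\<Inter>n. V n - A) \<in> null_sets lebesgue"
      by (auto simp: null_sets_def)
    have dens: "(\<integral>\<^sup>+ y\<in>X. g y \<partial>lebesgue) = emeasure (density lebesgue g) X" if "X \<in> sets lebesgue" for X
      using that by (simp add: emeasure_density)
    have "(\<lambda>n. emeasure (density lebesgue g) (V n - A)) \<longlonglongrightarrow> emeasure (density lebesgue g) (\<Inter>n. V n - A)"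
    proof (rule Lim_emeasure_decseq[OF _ dec])
      show "emeasure (density lebesgue g) (V n - A) \<noteq> \<infinity>" for n
      proof -
        have "(\<integral>\<^sup>+ y\<in>V n - A. g y \<partial>lebesgue) \<le> (\<integral>\<^sup>+ y. g y \<partial>lebesgue)"
          by (intro nn_integral_mono) (auto simp: indicator_def)
        then show ?thesis using fin by (auto simp: dens top_unique)
      qed
    qed auto
    moreover have "emeasure (density lebesgue g) (\<Inter>n. V n - A) = 0"
    proof -
      have "AE y in lebesgue. g y * indicator (\<Inter>n. V n - A) y = 0"
        using AE_not_in[OF null] by eventually_elim (auto simp: indicator_def)
      from nn_integral_cong_AE[OF this]
      have "(\<integral>\<^sup>+ y\<in>(\<Inter>n. V n - A). g y \<partial>lebesgue) = 0" by simp
      then show ?thesis by (subst dens[symmetric]) auto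
    qed
    ultimately have "eventually (\<lambda>n. emeasure (density lebesgue g) (V n - A) < ennreal e) sequentially"
      using that by (simp add: order_tendsto_iff)
    then obtain n where n: "emeasure (density lebesgue g) (V n - A) < ennreal e"
      by (auto simp: eventually_sequentially)
    have "(\<integral>\<^sup>+ y\<in>V n. g y \<partial>lebesgue) = (\<integral>\<^sup>+ y\<in>V n - A. g y \<partial>lebesgue)"
      using zero by (intro nn_integral_cong) (auto simp: indicator_def)
    then show ?thesis using n oV AV by (intro exI[of _ "V n"]) (auto simp: dens)
  qed
  have negl: "negligible (bad \<epsilon>)" if \<epsilon>: "\<epsilon> > 0" for \<epsilon>
    unfolding negligible_outer_le
  proof (intro allI impI)
    fix e :: real assume e: "e > 0"
    define e' where "e' = e * \<epsilon> / 5 ^ DIM('b)"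
    have "e' > 0" using e \<epsilon> by (simp add: e'_def)
    then obtain U where U: "open U" "A \<subseteq> U" "(\<integral>\<^sup>+ y\<in>U. g y \<partial>lebesgue) < ennreal e'"
      using small_open by blast
    have "\<forall>x\<in>bad \<epsilon>. \<exists>h. 0 < h \<and> h \<le> 1 \<and> cball x h \<subseteq> U \<and>
        ennreal \<epsilon> * emeasure lebesgue (cball x h) < (\<integral>\<^sup>+ y\<in>cball x h. g y \<partial>lebesgue)"
    proof
      fix x assume x: "x \<in> bad \<epsilon>"
      have "x \<in> U" using x U by (auto simp: bad_def)
      then obtain d where d: "d > 0" "cball x d \<subseteq> U" using U(1) open_contains_cball by blast
      then have "min d 1 > 0" by simp
      then obtain h where "0 < h" "h \<le> min d 1"
         "ennreal \<epsilon> * emeasure lebesgue (cball x h) < (\<integral>\<^sup>+ y\<in>cball x h. g y \<partial>lebesgue)"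
        using x unfolding bad_def by blast
      moreover have "cball x h \<subseteq> U"
        using d(2) \<open>h \<le> min d 1\<close> by (intro order_trans[OF subset_cball d(2)]) simp
      ultimately show "\<exists>h. 0 < h \<and> h \<le> 1 \<and> cball x h \<subseteq> U \<and>
        ennreal \<epsilon> * emeasure lebesgue (cball x h) < (\<integral>\<^sup>+ y\<in>cball x h. g y \<partial>lebesgue)"
        by (intro exI[of _ h]) simp
    qed
    from bchoice[OF this]
    obtain \<rho> where "\<forall>x\<in>bad \<epsilon>. 0 < \<rho> x \<and> \<rho> x \<le> 1 \<and> cball x (\<rho> x) \<subseteq> U \<and>
        ennreal \<epsilon> * emeasure lebesgue (cball x (\<rho> x)) < (\<integral>\<^sup>+ y\<in>cball x (\<rho> x). g y \<partial>lebesgue)"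
      by blast
    then have \<rho>: "\<And>x. x \<in> bad \<epsilon> \<Longrightarrow> 0 < \<rho> x \<and> \<rho> x \<le> 1" "\<And>x. x \<in> bad \<epsilon> \<Longrightarrow> cball x (\<rho> x) \<subseteq> U"
       "\<And>x. x \<in> bad \<epsilon> \<Longrightarrow> ennreal \<epsilon> * emeasure lebesgue (cball x (\<rho> x)) < (\<integral>\<^sup>+ y\<in>cball x (\<rho> x). g y \<partial>lebesgue)"
      by blast+
    have sub: "bad \<epsilon> \<subseteq> (\<Union>i\<in>bad \<epsilon>. cball i (\<rho> i))"
    proof
      fix x assume "x \<in> bad \<epsilon>"
      moreover from \<rho>(1)[OF this] have "x \<in> cball x (\<rho> x)" by simp
      ultimately show "x \<in> (\<Union>i\<in>bad \<epsilon>. cball i (\<rho> i))" by (rule UN_I)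
    qed
    obtain C where C: "countable C" "C \<subseteq> bad \<epsilon>"
       "pairwise (\<lambda>i j. disjnt (cball i (\<rho> i)) (cball j (\<rho> j))) C"
       "bad \<epsilon> \<subseteq> (\<Union>i\<in>C. cball i (5 * \<rho> i))"
      by (rule Vitali_covering_lemma_cballs[OF sub \<rho>(1)])
    let ?T = "\<Union>i\<in>C. cball i (5 * \<rho> i)"
    have T [measurable]: "?T \<in> sets lebesgue"
      using C(1) by (intro sets.countable_UN') auto
    have five: "emeasure lebesgue (cball i (5 * \<rho> i)) = ennreal (5 ^ DIM('b)) * emeasure lebesgue (cball i (\<rho> i))"
      if "i \<in> C" for i
    proof -
      have "0 < \<rho> i" using \<rho>(1) that C(2) by blast
      then show ?thesis
        by (simp add: emeasure_cball ennreal_mult'[symmetric] power_mult_distrib mult_ac)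
    qed
    let ?\<nu> = "density lebesgue g"
    have "emeasure lebesgue ?T = (\<integral>\<^sup>+ x. indicator ?T x \<partial>lebesgue)" by simp
    also have "\<dots> \<le> (\<integral>\<^sup>+ x. \<integral>\<^sup>+ i. indicator (cball i (5 * \<rho> i)) x \<partial>count_space C \<partial>lebesgue)"
    proof (rule nn_integral_mono)
      fix x
      show "indicator ?T x \<le> (\<integral>\<^sup>+ i. indicator (cball i (5 * \<rho> i)) x \<partial>count_space C)"
      proof (cases "x \<in> ?T")
        case True
        then obtain i where i: "i \<in> C" "x \<in> cball i (5 * \<rho> i)" by blast
        then show ?thesis
          using nn_integral_ge_point[OF i(1), of "\<lambda>i. indicator (cball i (5 * \<rho> i)) x"] True
          by simp
      qed simp
    qed
    also have "\<dots> = (\<integral>\<^sup>+ i. emeasure lebesgue (cball i (5 * \<rho> i)) \<partial>count_space C)"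
      using C(1) by (subst nn_integral_count_space_nn_integral) auto
    finally have "ennreal \<epsilon> * emeasure lebesgue ?T
        \<le> ennreal \<epsilon> * (\<integral>\<^sup>+ i. emeasure lebesgue (cball i (5 * \<rho> i)) \<partial>count_space C)"
      by (rule mult_left_mono) simp
    also have "\<dots> = (\<integral>\<^sup>+ i. ennreal (5 ^ DIM('b)) * (ennreal \<epsilon> * emeasure lebesgue (cball i (\<rho> i))) \<partial>count_space C)"
      by (subst nn_integral_cmult[symmetric], simp, intro nn_integral_cong)
         (simp only: space_count_space five mult.left_commute)
    also have "\<dots> \<le> (\<integral>\<^sup>+ i. ennreal (5 ^ DIM('b)) * emeasure ?\<nu> (cball i (\<rho> i)) \<partial>count_space C)"
      using \<rho>(3) C(2) by (intro nn_integral_mono mult_left_mono) (auto simp: emeasure_density less_imp_le)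
    also have "\<dots> = ennreal (5 ^ DIM('b)) * emeasure ?\<nu> (\<Union>i\<in>C. cball i (\<rho> i))"
      using C(1,3)
      by (subst emeasure_UN_countable)
         (auto simp: nn_integral_cmult disjoint_family_on_def pairwise_def disjnt_def)
    also have "\<dots> \<le> ennreal (5 ^ DIM('b)) * emeasure ?\<nu> U"
      using \<rho>(2) C(2) U(1) by (intro mult_left_mono emeasure_mono) (auto simp: borel_open)
    also have "\<dots> \<le> ennreal (5 ^ DIM('b)) * ennreal e'"
      using U(1,3) by (intro mult_left_mono) (auto simp: emeasure_density borel_open)
    also have "\<dots> = ennreal \<epsilon> * ennreal e"
      using e \<epsilon> by (simp add: e'_def ennreal_mult'[symmetric] mult_ac)
    finally have le: "emeasure lebesgue ?T \<le> ennreal e"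
      using \<epsilon> by (simp add: ennreal_mult_le_mult_iff)
    show "\<exists>T. bad \<epsilon> \<subseteq> T \<and> T \<in> lmeasurable \<and> measure lebesgue T \<le> e"
      using C(4) le e T
      by (intro exI[of _ ?T]) (auto simp: fmeasurable_def measure_def enn2real_leI intro: le_less_trans)
  qed
  have null: "(\<Union>n. bad (1 / real (Suc n))) \<in> null_sets lebesgue"
    using negl by (intro null_sets_UN) (auto simp: negligible_iff_null_sets)
  show ?thesis
    using AE_not_in[OF null]
  proof eventually_elim
    case (elim x)
    show ?case
    proof (intro impI allI)
      fix \<epsilon> :: real assume x: "x \<in> A" and "\<epsilon> > 0"
      then obtain n where n: "1 / real (Suc n) < \<epsilon>" using nat_approx_posE by blast
      have "x \<notin> bad (1 / real (Suc n))" using elim by blast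
      then obtain d where d: "d > 0" "\<And>h. 0 < h \<Longrightarrow> h \<le> d \<Longrightarrow> (\<integral>\<^sup>+ y\<in>cball x h. g y \<partial>lebesgue)
          \<le> ennreal (1 / real (Suc n)) * emeasure lebesgue (cball x h)"
        using x unfolding bad_def mem_Collect_eq not_less[symmetric] by blast
      have "ennreal (1 / real (Suc n)) * m \<le> ennreal \<epsilon> * m" for m
        using n by (intro mult_right_mono ennreal_leI) auto
      then show "\<exists>d>0. \<forall>h. 0 < h \<and> h \<le> d \<longrightarrow>
              (\<integral>\<^sup>+ y\<in>cball x h. g y \<partial>lebesgue) \<le> ennreal \<epsilon> * emeasure lebesgue (cball x h)"
        using d by (meson order_trans)
    qed
  qed
qed

text \<open>
  For \<open>q\<close> in a countable dense set and \<open>a\<close> rational, \<open>zero_density\<close> applies to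
  \<open>norm (f y - q) powr p\<close> cut off where \<open>norm (f y - q) \<le> a\<close>.  Outside a null set, a point
  \<open>x\<close> can be treated with some \<open>q\<close> within \<open>a\<close> of \<open>f x\<close>, and
  \<open>norm (f y - f x) powr p\<close> is then at most \<open>(2 * a) powr p\<close> plus \<open>2 powr p\<close> times the cut-off
  function.
\<close>

lemma lebesgue_points:
  fixes f :: "'b::euclidean_space \<Rightarrow> 'a::euclidean_space" and p :: real
  assumes f [measurable]: "f \<in> borel_measurable lebesgue" and "p > 0"
    and S: "open S" "S \<in> lmeasurable"
    and fin: "(\<integral>\<^sup>+ y\<in>S. ennreal (norm (f y) powr p) \<partial>lebesgue) < \<infinity>"
  shows "AE x in lebesgue. x \<in> S \<longrightarrow>
           (\<forall>\<epsilon>>0. \<exists>d>0. \<forall>h. 0 < h \<and> h \<le> d \<longrightarrow>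
              (\<integral>\<^sup>+ y\<in>cball x h. ennreal (norm (f y - f x) powr p) \<partial>lebesgue)
                \<le> ennreal \<epsilon> * emeasure lebesgue (cball x h))"
proof -
  obtain D :: "'a set" where D: "countable D" "\<And>X. open X \<Longrightarrow> X \<noteq> {} \<Longrightarrow> \<exists>d\<in>D. d \<in> X"
    using countable_dense_setE by metis
  define A where "A q a = {y \<in> S. norm (f y - q) \<le> a}" for q and a :: real
  define g where "g q a y = ennreal (norm (f y - q) powr p) * indicator (S - A q a) y" for q a y
  have [measurable]: "S \<in> sets lebesgue" using S by auto
  have Am [measurable]: "A q a \<in> sets lebesgue" for q a
  proof -
    have "A q a = S \<inter> {y \<in> space lebesgue. norm (f y - q) \<le> a}" by (auto simp: A_def)
    also have "\<dots> \<in> sets lebesgue" by measurable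
    finally show ?thesis .
  qed
  have gm [measurable]: "g q a \<in> borel_measurable lebesgue" for q a
    unfolding g_def by measurable
  have cb [measurable]: "cball x h \<in> sets lebesgue" for x :: 'b and h
    by (simp add: borel_closed)
  have two: "(a + b) powr p \<le> 2 powr p * a powr p + 2 powr p * b powr p" if "a \<ge> 0" "b \<ge> 0" for a b :: real
  proof -
    have "(a + b) powr p \<le> (2 * max a b) powr p" using that \<open>p > 0\<close> by (intro powr_mono2) auto
    also have "\<dots> = 2 powr p * (max a b) powr p" using that by (simp add: powr_mult)
    also have "\<dots> \<le> 2 powr p * a powr p + 2 powr p * b powr p" by (auto simp: max_def)
    finally show ?thesis .
  qed
  have "AE x in lebesgue. \<forall>q\<in>D. \<forall>a\<in>\<rat>. x \<in> A q a \<longrightarrow>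
           (\<forall>\<epsilon>>0. \<exists>d>0. \<forall>h. 0 < h \<and> h \<le> d \<longrightarrow>
              (\<integral>\<^sup>+ y\<in>cball x h. g q a y \<partial>lebesgue) \<le> ennreal \<epsilon> * emeasure lebesgue (cball x h))"
    unfolding AE_ball_countable[OF D(1)] AE_ball_countable[OF countable_rat]
  proof (intro ballI zero_density)
    \<comment> \<open>Integrability of the cut-off function: \<open>S\<close> has finite measure, so constants are integrable.\<close>
    fix q and a :: real
    have "(\<integral>\<^sup>+ y. g q a y \<partial>lebesgue) \<le> (\<integral>\<^sup>+ y. ennreal (2 powr p) * (ennreal (norm (f y) powr p) * indicator S y)
             + ennreal (2 powr p * norm q powr p) * indicator S y \<partial>lebesgue)"
    proof (rule nn_integral_mono)
      fix y
      have "norm (f y - q) powr p \<le> (norm (f y) + norm q) powr p"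
        using \<open>p > 0\<close> by (intro powr_mono2 norm_triangle_ineq4) auto
      also have "\<dots> \<le> 2 powr p * norm (f y) powr p + 2 powr p * norm q powr p"
        by (rule two) auto
      finally have "ennreal (norm (f y - q) powr p) \<le> ennreal (2 powr p) * ennreal (norm (f y) powr p) + ennreal (2 powr p * norm q powr p)"
        by (simp add: ennreal_mult'[symmetric] ennreal_plus[symmetric] del: ennreal_plus)
      then show "g q a y \<le> ennreal (2 powr p) * (ennreal (norm (f y) powr p) * indicator S y)
             + ennreal (2 powr p * norm q powr p) * indicator S y"
        by (auto simp: g_def indicator_def)
    qed
    also have "\<dots> = ennreal (2 powr p) * (\<integral>\<^sup>+ y\<in>S. ennreal (norm (f y) powr p) \<partial>lebesgue)
          + ennreal (2 powr p * norm q powr p) * emeasure lebesgue S"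
      by (subst nn_integral_add) (auto simp: nn_integral_cmult)
    also have "\<dots> < \<infinity>"
      using fin S by (auto simp: ennreal_mult_less_top fmeasurable_def)
    finally show "(\<integral>\<^sup>+ y. g q a y \<partial>lebesgue) < \<infinity>" .
    show "g q a \<in> borel_measurable lebesgue" by (rule gm)
  qed (auto simp: g_def)
  then show ?thesis
  proof eventually_elim
    case (elim x)
    show ?case
    proof (intro impI allI)
      fix \<epsilon> :: real assume x: "x \<in> S" and \<epsilon>: "\<epsilon> > 0"
      have "((\<lambda>a. (2 * a) powr p) \<longlongrightarrow> (2 * 0) powr p) (at_right (0::real))"
        using \<open>p > 0\<close> by (intro tendsto_powr' tendsto_intros) (auto simp: eventually_at_right_field intro: exI[of _ 1])
      then have "eventually (\<lambda>a. (2 * a) powr p < \<epsilon> / 2) (at_right (0::real))"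
        using \<epsilon> \<open>p > 0\<close> by (intro order_tendstoD) auto
      then obtain b where b: "b > 0" "\<And>a. 0 < a \<Longrightarrow> a < b \<Longrightarrow> (2 * a) powr p < \<epsilon> / 2"
        by (auto simp: eventually_at_right_field)
      obtain a where a: "a \<in> \<rat>" "0 < a" "a < b" using Rats_dense_in_real[OF b(1)] by blast
      obtain q where q: "q \<in> D" "q \<in> ball (f x) a"
        using D(2)[of "ball (f x) a"] a by auto
      then have xq: "norm (f x - q) \<le> a" by (auto simp: dist_norm)
      then have "x \<in> A q a" using x by (auto simp: A_def)
      from elim[THEN bspec, OF q(1), THEN bspec, OF a(1), THEN mp, OF this,
          THEN spec, of "\<epsilon> / (2 * 2 powr p)"] \<epsilon>
      obtain d where d: "d > 0" "\<And>h. 0 < h \<Longrightarrow> h \<le> d \<Longrightarrow>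
         (\<integral>\<^sup>+ y\<in>cball x h. g q a y \<partial>lebesgue) \<le> ennreal (\<epsilon> / (2 * 2 powr p)) * emeasure lebesgue (cball x h)"
        by auto
      obtain d' where d': "d' > 0" "cball x d' \<subseteq> S" using S x open_contains_cball by blast
      show "\<exists>d>0. \<forall>h. 0 < h \<and> h \<le> d \<longrightarrow>
              (\<integral>\<^sup>+ y\<in>cball x h. ennreal (norm (f y - f x) powr p) \<partial>lebesgue)
                \<le> ennreal \<epsilon> * emeasure lebesgue (cball x h)"
      proof (intro exI[of _ "min d d'"] conjI allI impI)
        fix h assume h: "0 < h \<and> h \<le> min d d'"
        have "(\<integral>\<^sup>+ y\<in>cball x h. ennreal (norm (f y - f x) powr p) \<partial>lebesgue)
            \<le> (\<integral>\<^sup>+ y. ennreal (\<epsilon> / 2) * indicator (cball x h) y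
                 + ennreal (2 powr p) * (g q a y * indicator (cball x h) y) \<partial>lebesgue)"
        proof (rule nn_integral_mono)
          fix y
          have "ennreal (norm (f y - f x) powr p) \<le> ennreal (\<epsilon> / 2) + ennreal (2 powr p) * g q a y"
            if y: "y \<in> cball x h"
          proof -
            have yS: "y \<in> S" using y h d' by auto
            have tri: "norm (f y - f x) \<le> norm (f y - q) + a"
              using norm_triangle_ineq4[of "f y - q" "f x - q"] xq by simp
            show ?thesis
            proof (cases "norm (f y - q) \<le> a")
              case True
              then have "norm (f y - f x) powr p \<le> (2 * a) powr p"
                using tri \<open>p > 0\<close> by (intro powr_mono2) auto
              also have "\<dots> \<le> \<epsilon> / 2" using b(2) a by (simp add: less_imp_le)
              finally show ?thesis by (simp add: add_increasing2 ennreal_leI)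
            next
              case False
              then have "norm (f y - f x) powr p \<le> (2 * norm (f y - q)) powr p"
                using tri \<open>p > 0\<close> by (intro powr_mono2) auto
              then have "norm (f y - f x) powr p \<le> 2 powr p * norm (f y - q) powr p"
                by (simp add: powr_mult)
              moreover have "g q a y = ennreal (norm (f y - q) powr p)"
                using False yS by (auto simp: g_def A_def)
              ultimately show ?thesis
                by (simp add: ennreal_mult'[symmetric] add_increasing ennreal_leI)
            qed
          qed
          then show "ennreal (norm (f y - f x) powr p) * indicator (cball x h) y
            \<le> ennreal (\<epsilon> / 2) * indicator (cball x h) y
                 + ennreal (2 powr p) * (g q a y * indicator (cball x h) y)"
            by (auto simp: indicator_def)
        qed
        also have "\<dots> = ennreal (\<epsilon> / 2) * emeasure lebesgue (cball x h)
             + ennreal (2 powr p) * (\<integral>\<^sup>+ y\<in>cball x h. g q a y \<partial>lebesgue)"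
        proof -
          have ind: "(\<integral>\<^sup>+ y. ennreal (\<epsilon> / 2) * indicator (cball x h) y \<partial>lebesgue)
              = ennreal (\<epsilon> / 2) * emeasure lebesgue (cball x h)"
            by (rule nn_integral_cmult_indicator) simp
          have mult: "(\<integral>\<^sup>+ y. ennreal (2 powr p) * (g q a y * indicator (cball x h) y) \<partial>lebesgue)
              = ennreal (2 powr p) * (\<integral>\<^sup>+ y\<in>cball x h. g q a y \<partial>lebesgue)"
            by (rule nn_integral_cmult) measurable
          show ?thesis unfolding ind[symmetric] mult[symmetric]
            by (rule nn_integral_add) measurable
        qed
        also have "\<dots> \<le> ennreal (\<epsilon> / 2) * emeasure lebesgue (cball x h)
             + ennreal (2 powr p) * (ennreal (\<epsilon> / (2 * 2 powr p)) * emeasure lebesgue (cball x h))"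
          using d(2)[of h] h by (intro add_left_mono mult_left_mono) auto
        also have "\<dots> = (ennreal (\<epsilon> / 2) + ennreal (2 powr p) * ennreal (\<epsilon> / (2 * 2 powr p))) * emeasure lebesgue (cball x h)"
          by (simp add: distrib_right mult.assoc)
        also have "ennreal (\<epsilon> / 2) + ennreal (2 powr p) * ennreal (\<epsilon> / (2 * 2 powr p)) = ennreal \<epsilon>"
          using \<epsilon> by (simp add: ennreal_mult'[symmetric] ennreal_plus[symmetric] del: ennreal_plus)
        finally show "(\<integral>\<^sup>+ y\<in>cball x h. ennreal (norm (f y - f x) powr p) \<partial>lebesgue)
                \<le> ennreal \<epsilon> * emeasure lebesgue (cball x h)" .
      qed (use d d' in auto)
    qed
  qed
qed

section \<open>Integration of periodic functions\<close>

lemma translate_reflect_measurable: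
  fixes y c :: real
  assumes "\<bar>c\<bar> = 1"
  shows "(\<lambda>t. y + c * t) \<in> lebesgue \<rightarrow>\<^sub>M lebesgue"
  using lebesgue_affine_measurable[of "\<lambda>_. c" y] assms by (auto simp: abs_if split: if_splits)

lemma periodic_borel_measurable:
  fixes g :: "real \<Rightarrow> 'a::topological_space"
  assumes per: "periodic_fun_simple g (2 * pi)" and g: "g \<in> borel_measurable circle"
  shows "g \<in> borel_measurable lebesgue"
proof -
  interpret periodic_fun_simple g "2 * pi" by fact
  define \<Omega> where "\<Omega> k = {-pi + of_int k * (2 * pi)..pi + of_int k * (2 * pi)}" for k :: int
  have "g \<in> borel_measurable (restrict_space lebesgue (\<Omega> k))" for k
  proof -
    have 1: "(\<lambda>t. - of_int k * (2 * pi) + 1 * t) \<in> lebesgue \<rightarrow>\<^sub>M lebesgue"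
      by (rule translate_reflect_measurable) simp
    have "(\<lambda>t. - of_int k * (2 * pi) + 1 * t) \<in> restrict_space lebesgue (\<Omega> k) \<rightarrow>\<^sub>M circle"
      by (intro measurable_restrict_space2 measurable_restrict_space1 1) (auto simp: \<Omega>_def space_restrict_space)
    from measurable_compose[OF this g]
    have "(\<lambda>t. g (t - of_int k * (2 * pi))) \<in> borel_measurable (restrict_space lebesgue (\<Omega> k))"
      by simp
    then show ?thesis by (simp add: minus_of_int)
  qed
  note meas = this
  have cover: "t \<in> \<Union>(range \<Omega>)" for t
  proof -
    have "t \<in> \<Omega> \<lfloor>(t + pi) / (2 * pi)\<rfloor>"
      using floor_divide_lower[of "2 * pi" "t + pi"] floor_divide_upper[of "2 * pi" "t + pi"]
      by (simp add: \<Omega>_def algebra_simps)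
    then show ?thesis by blast
  qed
  show ?thesis
  proof (rule measurable_piecewise_restrict[of "range \<Omega>"])
    show "space lebesgue \<subseteq> \<Union>(range \<Omega>)" using cover by blast
  qed (use meas in \<open>auto simp: \<Omega>_def\<close>)
qed

text \<open>
  Half-open intervals of integration can be split and rejoined without exceptional points.
\<close>

lemma nn_integral_circle: "(\<integral>\<^sup>+ t. F t \<partial>circle) = (\<integral>\<^sup>+ t\<in>{-pi..<pi}. F t \<partial>lebesgue)"
proof -
  have "(\<integral>\<^sup>+ t. F t \<partial>circle) = (\<integral>\<^sup>+ t\<in>{-pi..pi}. F t \<partial>lebesgue)"
    by (simp add: nn_integral_restrict_space)
  also have "\<dots> = (\<integral>\<^sup>+ t\<in>{-pi..<pi}. F t \<partial>lebesgue)"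
  proof (rule nn_integral_cong_AE)
    have "{pi} \<in> null_sets lebesgue" by (intro null_sets_completionI finite_imp_null_set_lborel) simp
    from AE_not_in[OF this]
    show "AE t in lebesgue. F t * indicator {-pi..pi} t = F t * indicator {-pi..<pi} t"
      by eventually_elim (auto simp: indicator_def)
  qed
  finally show ?thesis .
qed

lemma nn_integral_circle_translate:
  fixes F :: "real \<Rightarrow> ennreal"
  assumes per: "periodic_fun_simple F (2 * pi)" and F [measurable]: "F \<in> borel_measurable lebesgue"
  shows "(\<integral>\<^sup>+ t. F (y + t) \<partial>circle) = (\<integral>\<^sup>+ t. F t \<partial>circle)"
proof -
  interpret periodic_fun_simple F "2 * pi" by fact
  have [measurable]: "{a..<b} \<in> sets lebesgue" for a b :: real by simp
  define I where "I a b = (\<integral>\<^sup>+ t\<in>{a..<b}. F t \<partial>lebesgue)" for a b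
  have trans: "(\<integral>\<^sup>+ t\<in>{a..<b}. F (z + t) \<partial>lebesgue) = I (a + z) (b + z)" for a b z
  proof -
    have m: "(\<lambda>t. F t * indicator {a+z..<b+z} t) \<in> borel_measurable lebesgue" by measurable
    have "I (a + z) (b + z) = (\<integral>\<^sup>+ t. F (z + t) * indicator {a+z..<b+z} (z + t) \<partial>lebesgue)"
      unfolding I_def using nn_integral_real_affine_lebesgue[OF m, of 1 z] by simp
    also have "\<dots> = (\<integral>\<^sup>+ t\<in>{a..<b}. F (z + t) \<partial>lebesgue)"
      by (intro nn_integral_cong) (auto simp: indicator_def)
    finally show ?thesis ..
  qed
  have step: "I (a + of_int k * (2 * pi)) (b + of_int k * (2 * pi)) = I a b" for a b and k :: int
  proof -
    have "F (of_int k * (2 * pi) + t) = F t" for t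
      using plus_of_int[of t k] by (simp add: add.commute)
    then show ?thesis using trans[where a=a and b=b and z="of_int k * (2 * pi)"] by (simp add: I_def)
  qed
  have split: "I a c = I a b + I b c" if "a \<le> b" "b \<le> c" for a b c
  proof -
    have "I a c = (\<integral>\<^sup>+ t. F t * indicator {a..<b} t + F t * indicator {b..<c} t \<partial>lebesgue)"
      unfolding I_def using that by (intro nn_integral_cong) (auto simp: indicator_def)
    also have "\<dots> = I a b + I b c"
      unfolding I_def by (rule nn_integral_add) measurable
    finally show ?thesis .
  qed
  \<comment> \<open>Only a translation by \<open>z\<close>, less than one period, needs a splitting of the interval.\<close>
  define k where "k = \<lfloor>y / (2 * pi)\<rfloor>"
  define z where "z = y - of_int k * (2 * pi)"
  have z: "0 \<le> z" "z \<le> 2 * pi"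
    using floor_divide_lower[of "2 * pi" y] floor_divide_upper[of "2 * pi" y]
    by (auto simp: z_def k_def algebra_simps)
  have "(\<integral>\<^sup>+ t. F (y + t) \<partial>circle) = I (- pi + y) (pi + y)"
    by (simp add: nn_integral_circle trans)
  also have "\<dots> = I (- pi + z) (pi + z)"
    using step[of "- pi + z" k "pi + z"] by (simp add: z_def algebra_simps)
  also have "\<dots> = I (- pi + z) pi + I pi (pi + z)"
    using z by (intro split) auto
  also have "I pi (pi + z) = I (- pi) (- pi + z)"
    using step[of "- pi" 1 "- pi + z"] by (simp add: algebra_simps)
  also have "I (- pi + z) pi + I (- pi) (- pi + z) = I (- pi) pi"
    using z by (subst split[of "- pi" "- pi + z" pi]) (auto simp: add.commute)
  finally show ?thesis by (simp add: nn_integral_circle I_def)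
qed

lemma nn_integral_circle_rotate_reflect:
  fixes F :: "real \<Rightarrow> ennreal"
  assumes per: "periodic_fun_simple F (2 * pi)" and F [measurable]: "F \<in> borel_measurable lebesgue"
  shows "(\<integral>\<^sup>+ t. F (y - t) \<partial>circle) = (\<integral>\<^sup>+ t. F t \<partial>circle)"
proof -
  have [measurable]: "{-pi..pi} \<in> sets lebesgue" by simp
  have m: "(\<lambda>t. y + t) \<in> lebesgue \<rightarrow>\<^sub>M lebesgue" "(\<lambda>t. y - t) \<in> lebesgue \<rightarrow>\<^sub>M lebesgue"
    using translate_reflect_measurable[of 1 y] translate_reflect_measurable[of "-1" y] by simp_all
  note [measurable] = measurable_compose[OF m(1) F] measurable_compose[OF m(2) F]
  have "(\<integral>\<^sup>+ t. F (y - t) \<partial>circle) = (\<integral>\<^sup>+ t\<in>{-pi..pi}. F (y - t) \<partial>lebesgue)"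
    by (simp add: nn_integral_restrict_space)
  also have "\<dots> = (\<integral>\<^sup>+ t\<in>{-pi..pi}. F (y + t) \<partial>lebesgue)"
    by (subst nn_integral_real_affine_lebesgue[where c="-1" and t=0])
       (measurable, auto intro!: nn_integral_cong simp: indicator_def)
  also have "\<dots> = (\<integral>\<^sup>+ t. F (y + t) \<partial>circle)"
    by (simp add: nn_integral_restrict_space)
  also have "\<dots> = (\<integral>\<^sup>+ t. F t \<partial>circle)"
    by (rule nn_integral_circle_translate[OF per F])
  finally show ?thesis .
qed

text \<open>
  Equality of the image measures transfers the invariance from nonnegative functions to vector
  valued integrals and to essential suprema without a further splitting of intervals.
\<close>

lemma distr_circle_rotate_reflect:
  fixes g :: "real \<Rightarrow> 'a::topological_space"
  assumes per: "periodic_fun_simple g (2 * pi)" and g [measurable]: "g \<in> borel_measurable lebesgue"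
  shows "(\<lambda>t. g (y - t)) \<in> borel_measurable circle"
    and "distr circle borel (\<lambda>t. g (y - t)) = distr circle borel g"
proof -
  interpret periodic_fun_simple g "2 * pi" by fact
  have "(\<lambda>t. y - t) \<in> lebesgue \<rightarrow>\<^sub>M lebesgue"
    using translate_reflect_measurable[of "-1" y] by simp
  from measurable_compose[OF this g]
  show m [measurable]: "(\<lambda>t. g (y - t)) \<in> borel_measurable circle"
    by (rule measurable_restrict_space1)
  have g' [measurable]: "g \<in> borel_measurable circle"
    using g by (rule measurable_restrict_space1)
  show "distr circle borel (\<lambda>t. g (y - t)) = distr circle borel g"
  proof (rule measure_eqI)
    fix B assume "B \<in> sets (distr circle borel (\<lambda>t. g (y - t)))"
    then have B [measurable]: "B \<in> sets borel" by simp
    have "emeasure (distr circle borel (\<lambda>t. g (y - t))) B = (\<integral>\<^sup>+ x. indicator B x \<partial>distr circle borel (\<lambda>t. g (y - t)))"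
      by simp
    also have "\<dots> = (\<integral>\<^sup>+ t. indicator B (g (y - t)) \<partial>circle)"
      by (rule nn_integral_distr) measurable
    also have "\<dots> = (\<integral>\<^sup>+ t. indicator B (g t) \<partial>circle)"
      by (rule nn_integral_circle_rotate_reflect[where F="\<lambda>t. indicator B (g t)"])
         (auto simp: periodic_fun_simple_def plus_1)
    also have "\<dots> = (\<integral>\<^sup>+ x. indicator B x \<partial>distr circle borel g)"
      by (rule nn_integral_distr[symmetric]) measurable
    finally show "emeasure (distr circle borel (\<lambda>t. g (y - t))) B = emeasure (distr circle borel g) B"
      by simp
  qed simp
qed

lemma integral_circle_rotate_reflect:
  fixes g :: "real \<Rightarrow> 'a::euclidean_space"
  assumes per: "periodic_fun_simple g (2 * pi)" and g: "g \<in> borel_measurable lebesgue"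
  shows "integrable circle (\<lambda>t. g (y - t)) \<longleftrightarrow> integrable circle g"
    and "(LINT t|circle. g (y - t)) = (LINT t|circle. g t)"
proof -
  note d = distr_circle_rotate_reflect[OF per g, of y]
  have g': "g \<in> borel_measurable circle"
    using g by (rule measurable_restrict_space1)
  show "integrable circle (\<lambda>t. g (y - t)) \<longleftrightarrow> integrable circle g"
    using integrable_distr_eq[OF d(1), of "\<lambda>x. x"] integrable_distr_eq[OF g', of "\<lambda>x. x"] d(2) by simp
  show "(LINT t|circle. g (y - t)) = (LINT t|circle. g t)"
    using integral_distr[OF d(1), of "\<lambda>x. x"] integral_distr[OF g', of "\<lambda>x. x"] d(2) by simp
qed

lemma circle_norm_rotate_reflect:
  fixes g :: "real \<Rightarrow> 'a::{real_normed_field, euclidean_space}"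
  assumes per: "periodic_fun_simple g (2 * pi)" and g: "g \<in> borel_measurable lebesgue"
  shows "circle_norm q (\<lambda>t. g (y - t)) = circle_norm q g"
proof -
  note d = distr_circle_rotate_reflect[OF per g, of y]
  have g': "g \<in> borel_measurable circle"
    using g by (rule measurable_restrict_space1)
  have "esssup circle (\<lambda>t. ennreal (norm (g (y - t)))) = esssup circle (\<lambda>t. ennreal (norm (g t)))"
  proof -
    have "(AE t in circle. ennreal (norm (g (y - t))) \<le> z) \<longleftrightarrow> (AE t in circle. ennreal (norm (g t)) \<le> z)" for z
    proof -
      have "{x \<in> space borel. ennreal (norm (x::'a)) \<le> z} \<in> sets borel" by measurable
      from AE_distr_iff[OF d(1) this] AE_distr_iff[OF g' this] show ?thesis
        unfolding d(2) by simp
    qed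
    then show ?thesis
      using d(1) g' by (simp add: esssup_eq_AE)
  qed
  moreover have "(\<integral>\<^sup>+ t. ennreal (norm (g (y - t)) powr s) \<partial>circle) = (\<integral>\<^sup>+ t. ennreal (norm (g t) powr s) \<partial>circle)" for s
    using nn_integral_distr[OF d(1), of "\<lambda>x. ennreal (norm x powr s)"] nn_integral_distr[OF g', of "\<lambda>x. ennreal (norm x powr s)"] d(2)
    by simp
  ultimately show ?thesis by (simp add: circle_norm_def)
qed

section \<open>The radial majorant\<close>

lemma AE_translate_reflect:
  fixes y c :: real
  assumes "\<bar>c\<bar> = 1" "AE u in lebesgue. P u"
  shows "AE t in lebesgue. P (y + c * t)"
proof -
  from assms(2) obtain N where N: "{u. \<not> P u} \<subseteq> N" "N \<in> null_sets lebesgue"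
    by (auto elim!: AE_E simp: null_sets_def)
  have "(\<lambda>t. y + c * t) -` N \<inter> space lebesgue \<in> null_sets lebesgue"
  proof -
    have [measurable]: "N \<in> sets lebesgue" using N by auto
    have "(\<integral>\<^sup>+ u. indicator N u \<partial>lebesgue) = \<bar>c\<bar> * (\<integral>\<^sup>+ t. indicator N (y + c * t) \<partial>lebesgue)"
      using assms(1) by (intro nn_integral_real_affine_lebesgue) auto
    moreover have "(\<integral>\<^sup>+ t. indicator N (y + c * t) \<partial>lebesgue) = (\<integral>\<^sup>+ t. indicator ((\<lambda>t. y + c * t) -` N) t \<partial>lebesgue)"
      by (intro nn_integral_cong) (auto simp: indicator_def)
    moreover have "(\<lambda>t. y + c * t) -` N \<in> sets lebesgue"
      using measurable_sets[OF translate_reflect_measurable[OF assms(1), of y], of N] by simp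
    ultimately show ?thesis using N assms(1) by (simp add: null_sets_def)
  qed
  from AE_not_in[OF this] show ?thesis
    by (rule eventually_mono) (use N in auto)
qed

text \<open>
  The bound up to \<open>2 * pi - x\<close> instead of \<open>pi\<close> comes from periodicity: the distance of such \<open>u\<close>
  from the period lattice is still at least \<open>x\<close>.  It is needed because \<open>\<theta> - s\<close> may leave the
  interval \<open>[-\<pi>, \<pi>]\<close>.
\<close>

lemma AE_le_radial_majorant:
  fixes g :: "real \<Rightarrow> 'a::{real_normed_field, euclidean_space}"
  assumes per: "periodic_fun_simple g (2 * pi)" and x: "0 < x"
  shows "AE u in lebesgue. x \<le> \<bar>u\<bar> \<and> \<bar>u\<bar> \<le> 2 * pi - x \<longrightarrow> ennreal (norm (g u)) \<le> radial_majorant g x"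
proof -
  interpret periodic_fun_simple g "2 * pi" by fact
  let ?P = "\<lambda>u. \<bar>x\<bar> \<le> \<bar>u\<bar> \<and> \<bar>u\<bar> \<le> pi \<longrightarrow> ennreal (norm (g u)) \<le> radial_majorant g x"
  have S: "{t. \<bar>x\<bar> \<le> \<bar>t\<bar> \<and> \<bar>t\<bar> \<le> pi} \<in> sets lebesgue"
  proof -
    have "{t. \<bar>x\<bar> \<le> \<bar>t\<bar> \<and> \<bar>t\<bar> \<le> pi} \<in> sets borel" by measurable
    then show ?thesis by simp
  qed
  have 0: "AE u in lebesgue. ?P u"
    using esssup_AE[where M="lebesgue_on {t. \<bar>x\<bar> \<le> \<bar>t\<bar> \<and> \<bar>t\<bar> \<le> pi}" and f="\<lambda>t. ennreal (norm (g t))"] S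
    by (simp add: AE_restrict_space_iff radial_majorant_def)
  have 1: "AE u in lebesgue. ?P (2 * pi + 1 * u)" "AE u in lebesgue. ?P (- (2 * pi) + 1 * u)"
    by (rule AE_translate_reflect[OF _ 0]; simp)+
  from 0 1 show ?thesis
  proof eventually_elim
    case (elim u)
    have shift: "g (2 * pi + 1 * u) = g u" "g (- (2 * pi) + 1 * u) = g u"
      using plus_1[of u] minus_1[of u] by (simp_all add: add.commute)
    show ?case
    proof
      assume u: "x \<le> \<bar>u\<bar> \<and> \<bar>u\<bar> \<le> 2 * pi - x"
      consider "\<bar>u\<bar> \<le> pi" | "u > pi" | "u < - pi" by linarith
      then show "ennreal (norm (g u)) \<le> radial_majorant g x"
      proof cases
        case 1 then show ?thesis using elim(1) u x by simp
      next
        case 2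
        then have "\<bar>x\<bar> \<le> \<bar>- (2 * pi) + 1 * u\<bar> \<and> \<bar>- (2 * pi) + 1 * u\<bar> \<le> pi" using u x by linarith
        with elim(3) show ?thesis unfolding shift by blast
      next
        case 3
        then have "\<bar>x\<bar> \<le> \<bar>2 * pi + 1 * u\<bar> \<and> \<bar>2 * pi + 1 * u\<bar> \<le> pi" using u x by linarith
        with elim(2) show ?thesis unfolding shift by blast
      qed
    qed
  qed
qed

lemma radial_majorant_antimono:
  fixes g :: "real \<Rightarrow> 'a::{real_normed_field, euclidean_space}"
  assumes g: "g \<in> borel_measurable lebesgue" and "0 \<le> x" "x \<le> y"
  shows "radial_majorant g y \<le> radial_majorant g x"
  unfolding radial_majorant_def
proof (rule esssup_I)
  have S: "{t. \<bar>x\<bar> \<le> \<bar>t\<bar> \<and> \<bar>t\<bar> \<le> pi} \<in> sets lebesgue" for x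
  proof -
    have "{t. \<bar>x\<bar> \<le> \<bar>t\<bar> \<and> \<bar>t\<bar> \<le> pi} \<in> sets borel" by measurable
    then show ?thesis by simp
  qed
  show "(\<lambda>t. ennreal (norm (g t))) \<in> borel_measurable (lebesgue_on {t. \<bar>y\<bar> \<le> \<bar>t\<bar> \<and> \<bar>t\<bar> \<le> pi})"
    using g by (intro measurable_restrict_space1) measurable
  have "AE t in lebesgue. \<bar>x\<bar> \<le> \<bar>t\<bar> \<and> \<bar>t\<bar> \<le> pi \<longrightarrow> ennreal (norm (g t))
      \<le> esssup (lebesgue_on {t. \<bar>x\<bar> \<le> \<bar>t\<bar> \<and> \<bar>t\<bar> \<le> pi}) (\<lambda>t. ennreal (norm (g t)))"
    using esssup_AE[where M="lebesgue_on {t. \<bar>x\<bar> \<le> \<bar>t\<bar> \<and> \<bar>t\<bar> \<le> pi}" and f="\<lambda>t. ennreal (norm (g t))"] S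
    by (simp add: AE_restrict_space_iff)
  then show "AE t in lebesgue_on {t. \<bar>y\<bar> \<le> \<bar>t\<bar> \<and> \<bar>t\<bar> \<le> pi}. ennreal (norm (g t))
      \<le> esssup (lebesgue_on {t. \<bar>x\<bar> \<le> \<bar>t\<bar> \<and> \<bar>t\<bar> \<le> pi}) (\<lambda>t. ennreal (norm (g t)))"
    using S assms(2,3) by (simp add: AE_restrict_space_iff) (erule eventually_mono, auto)
qed

text \<open>
  If \<open>\<bar>s\<bar> \<ge> 2 * \<bar>\<theta>\<bar>\<close> then \<open>\<bar>s\<bar> / 2 \<le> \<bar>\<theta> - s\<bar> \<le> 3 * \<bar>s\<bar> / 2\<close>, and the upper bound
  \<open>3 * pi / 2\<close> stays below \<open>2 * pi - x\<close>.
\<close>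

lemma AE_shifted_le_radial_majorant:
  fixes g :: "real \<Rightarrow> 'a::{real_normed_field, euclidean_space}"
  assumes per: "periodic_fun_simple g (2 * pi)" and x: "0 < x" "x \<le> pi / 2"
  shows "AE s in lebesgue. 2 * \<bar>\<theta>\<bar> \<le> \<bar>s\<bar> \<and> 2 * x \<le> \<bar>s\<bar> \<and> \<bar>s\<bar> \<le> pi
           \<longrightarrow> ennreal (norm (g (\<theta> - s))) \<le> radial_majorant g x"
proof -
  have "AE s in lebesgue. x \<le> \<bar>\<theta> + (-1) * s\<bar> \<and> \<bar>\<theta> + (-1) * s\<bar> \<le> 2 * pi - x
      \<longrightarrow> ennreal (norm (g (\<theta> + (-1) * s))) \<le> radial_majorant g x"
    by (rule AE_translate_reflect[OF _ AE_le_radial_majorant[OF per x(1)]]) simp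
  then show ?thesis
  proof eventually_elim
    case (elim s)
    show ?case
    proof
      assume "2 * \<bar>\<theta>\<bar> \<le> \<bar>s\<bar> \<and> 2 * x \<le> \<bar>s\<bar> \<and> \<bar>s\<bar> \<le> pi"
      then have "x \<le> \<bar>\<theta> - s\<bar> \<and> \<bar>\<theta> - s\<bar> \<le> 2 * pi - x" using x by linarith
      then show "ennreal (norm (g (\<theta> - s))) \<le> radial_majorant g x" using elim by simp
    qed
  qed
qed

section \<open>Estimates for one kernel\<close>

text \<open>
  Hoelder's inequality in the additive form given by Young's inequality with a weight.  The
  additive form treats \<open>p = 1\<close> and \<open>p > 1\<close> alike and keeps the factor \<open>N powr p\<close>, which
  the approach rate cancels exactly.
\<close>

lemma nn_integral_norm_mult_le:
  fixes g :: "real \<Rightarrow> 'a::{real_normed_field, euclidean_space}" and v :: "real \<Rightarrow> real"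
  assumes p: "1 \<le> p" and \<eta>: "0 < \<eta>"
    and g [measurable]: "g \<in> borel_measurable circle"
    and v [measurable]: "v \<in> borel_measurable circle" and v0: "\<And>t. 0 \<le> v t"
    and N: "N = enn2real (circle_norm (conj_exponent p) g)" "0 < N"
  shows "(\<integral>\<^sup>+ t. ennreal (norm (g t) * v t) \<partial>circle)
    \<le> ennreal \<eta> + ennreal (\<eta> powr (1 - p) * N powr p) * (\<integral>\<^sup>+ t. ennreal (v t powr p) \<partial>circle)"
proof (cases "p = 1")
  case True
  define E where "E = esssup circle (\<lambda>t. ennreal (norm (g t)))"
  have E: "N = enn2real E" using N True by (simp add: circle_norm_def conj_exponent_def E_def)
  then have EN: "E = ennreal N" using N(2) by (cases E) (auto simp: top_unique)
  have "AE t in circle. ennreal (norm (g t) * v t) \<le> ennreal N * ennreal (v t powr p)"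
    using esssup_AE[where M=circle and f="\<lambda>t. ennreal (norm (g t))"]
  proof eventually_elim
    case (elim t)
    then have "norm (g t) \<le> N" using N(2) by (simp add: EN[unfolded E_def])
    then have "norm (g t) * v t \<le> N * v t" using v0 by (rule mult_right_mono)
    then show ?case using v0[of t] N(2) True by (simp add: ennreal_mult'[symmetric] ennreal_leI)
  qed
  then have "(\<integral>\<^sup>+ t. ennreal (norm (g t) * v t) \<partial>circle) \<le> (\<integral>\<^sup>+ t. ennreal N * ennreal (v t powr p) \<partial>circle)"
    by (rule nn_integral_mono_AE)
  also have "\<dots> = ennreal N * (\<integral>\<^sup>+ t. ennreal (v t powr p) \<partial>circle)"
    by (rule nn_integral_cmult) measurable
  finally show ?thesis using True \<eta> N(2) by (simp add: add_increasing)
next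
  case False
  define q where "q = p / (p - 1)"
  have p1: "p > 1" using p False by simp
  then have q: "q > 1" "1 / p + 1 / q = 1" by (auto simp: q_def field_simps)
  define I where "I = (\<integral>\<^sup>+ t. ennreal (norm (g t) powr q) \<partial>circle)"
  have cn: "circle_norm (conj_exponent p) g = (if I = \<infinity> then \<infinity> else ennreal (enn2real I powr (1 / q)))"
    using p1 q by (simp add: circle_norm_def conj_exponent_def I_def q_def[symmetric] Let_def)
  have fin: "I \<noteq> \<infinity>" using N cn by (auto split: if_splits)
  have NI: "N = enn2real I powr (1 / q)" using N(1) cn fin by simp
  have "N powr q = enn2real I" unfolding NI using q by (simp add: powr_powr)
  then have I: "I = ennreal (N powr q)" using fin by (simp add: less_top)
  \<comment> \<open>The weight balances Young's inequality so that the first term integrates to at most \<open>\<eta>\<close>.\<close>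
  define \<beta> where "\<beta> = \<eta> powr (1 / q)"
  have \<beta>: "\<beta> > 0" "\<beta> powr q = \<eta>" "\<beta> powr p = \<eta> powr (p - 1)"
    using \<eta> q p1 by (auto simp: \<beta>_def powr_powr q_def)
  have pt: "norm (g t) * v t \<le> (\<eta> / N powr q) * norm (g t) powr q + (\<eta> powr (1 - p) * N powr p) * v t powr p" for t
  proof -
    have "norm (g t) * v t = (v t * N / \<beta>) * (\<beta> * norm (g t) / N)" using \<beta> N(2) by simp
    also have "\<dots> \<le> (v t * N / \<beta>) powr p / p + (\<beta> * norm (g t) / N) powr q / q"
      using p1 q v0[of t] \<beta> N(2) by (intro Youngs_inequality) auto
    also have "\<dots> \<le> (v t * N / \<beta>) powr p + (\<beta> * norm (g t) / N) powr q"
      using p1 q by (intro add_mono) (auto simp: divide_le_eq mult_le_cancel_left1 intro: order_less_imp_le)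
    also have "(v t * N / \<beta>) powr p = (\<eta> powr (1 - p) * N powr p) * v t powr p"
      using v0[of t] \<beta> N(2) powr_minus_divide[of \<eta> "p - 1"] by (simp add: powr_divide powr_mult)
    also have "(\<beta> * norm (g t) / N) powr q = (\<eta> / N powr q) * norm (g t) powr q"
      using \<beta> N(2) by (simp add: powr_divide powr_mult)
    finally show ?thesis by simp
  qed
  have "(\<integral>\<^sup>+ t. ennreal (norm (g t) * v t) \<partial>circle)
    \<le> (\<integral>\<^sup>+ t. ennreal (\<eta> / N powr q) * ennreal (norm (g t) powr q)
        + ennreal (\<eta> powr (1 - p) * N powr p) * ennreal (v t powr p) \<partial>circle)"
  proof (rule nn_integral_mono)
    fix t
    show "ennreal (norm (g t) * v t) \<le> ennreal (\<eta> / N powr q) * ennreal (norm (g t) powr q)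
        + ennreal (\<eta> powr (1 - p) * N powr p) * ennreal (v t powr p)"
      using pt[of t] \<eta> by (simp add: ennreal_mult'[symmetric] ennreal_plus[symmetric] ennreal_leI del: ennreal_plus)
  qed
  also have "\<dots> = ennreal (\<eta> / N powr q) * I
        + ennreal (\<eta> powr (1 - p) * N powr p) * (\<integral>\<^sup>+ t. ennreal (v t powr p) \<partial>circle)"
    by (simp add: nn_integral_add nn_integral_cmult I_def)
  also have "ennreal (\<eta> / N powr q) * I = ennreal \<eta>"
    unfolding I using N(2) \<eta> by (simp add: ennreal_mult'[symmetric])
  finally show ?thesis .
qed

lemma dyadic_annulus:
  fixes s :: real
  assumes "s \<noteq> 0" "\<bar>s\<bar> \<le> \<delta>"
  obtains k where "\<delta> / 2 ^ k / 2 < \<bar>s\<bar>" "\<bar>s\<bar> \<le> \<delta> / 2 ^ k"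
proof -
  have "\<delta> > 0" using assms by simp
  then obtain n where "(1/2) ^ n < \<bar>s\<bar> / \<delta>"
    using real_arch_pow_inv[of "\<bar>s\<bar> / \<delta>" "1/2"] assms by auto
  then have ex: "\<exists>n. \<delta> / 2 ^ n < \<bar>s\<bar>"
    using \<open>\<delta> > 0\<close> by (auto simp: field_simps power_divide)
  define n where "n = (LEAST n. \<delta> / 2 ^ n < \<bar>s\<bar>)"
  have n: "\<delta> / 2 ^ n < \<bar>s\<bar>" unfolding n_def using ex by (rule LeastI_ex)
  then obtain k where k: "n = Suc k" using assms by (cases n) auto
  then have "\<not> \<delta> / 2 ^ k < \<bar>s\<bar>" using not_less_Least[of k "\<lambda>n. \<delta> / 2 ^ n < \<bar>s\<bar>"] by (simp add: n_def[symmetric])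
  then show ?thesis using n k by (intro that[of k]) (auto simp: field_simps)
qed

text \<open>
  On the annulus \<open>d k / 2 < \<bar>s\<bar> \<le> d k\<close> with \<open>d k = \<delta> / 2 ^ k\<close> the kernel is at most the majorant
  at \<open>x k = d k / 4\<close>, so the annulus contributes at most \<open>\<epsilon> * d k\<close> times this value.  The
  interval from \<open>x k / 2\<close> to \<open>x k\<close> has length \<open>d k / 8\<close>, and there the majorant is at least its
  value at \<open>x k\<close>.  These intervals are disjoint, which gives the constant \<open>8\<close>.
\<close>

lemma annuli_estimate:
  fixes g :: "real \<Rightarrow> 'a::{real_normed_field, euclidean_space}" and G :: "real \<Rightarrow> ennreal"
  assumes per: "periodic_fun_simple g (2 * pi)" and g [measurable]: "g \<in> borel_measurable lebesgue"
    and G [measurable]: "G \<in> borel_measurable lebesgue"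
    and \<delta>: "0 < \<delta>" "\<delta> \<le> pi" and "0 \<le> \<epsilon>"
    and small: "\<And>h. 0 < h \<Longrightarrow> h \<le> \<delta> \<Longrightarrow> (\<integral>\<^sup>+ s\<in>{-h..h}. G s \<partial>lebesgue) \<le> ennreal (\<epsilon> * h)"
  shows "(\<integral>\<^sup>+ s\<in>{s. 2 * \<bar>\<theta>\<bar> < \<bar>s\<bar> \<and> \<bar>s\<bar> \<le> \<delta>}. ennreal (norm (g (\<theta> - s))) * G s \<partial>lebesgue)
    \<le> ennreal (8 * \<epsilon>) * (\<integral>\<^sup>+ x. radial_majorant g x \<partial>circle)"
proof -
  define d where "d k = \<delta> / 2 ^ k" for k :: nat
  define x where "x k = d k / 4" for k
  have d: "0 < d k" "d k \<le> \<delta>" "d (Suc k) = d k / 2" for k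
    using \<delta> by (auto simp: d_def divide_le_eq mult_le_cancel_left1)
  have dec: "d k \<le> d j" if "j \<le> k" for j k
    using \<delta> that by (auto simp: d_def intro!: divide_left_mono power_increasing)
  have [measurable]: "{-h..h} \<in> sets lebesgue" "{h<..l} \<in> sets lebesgue" for h l :: real by simp_all
  have single: "f k \<le> (\<Sum>k. f k)" for f :: "nat \<Rightarrow> ennreal" and k
    using sum_le_suminf[of f "{k}"] by simp
  have "AE s in lebesgue. \<forall>k. 2 * \<bar>\<theta>\<bar> \<le> \<bar>s\<bar> \<and> 2 * x k \<le> \<bar>s\<bar> \<and> \<bar>s\<bar> \<le> pi
           \<longrightarrow> ennreal (norm (g (\<theta> - s))) \<le> radial_majorant g (x k)"
    unfolding AE_all_countable
  proof
    fix k
    have "0 < x k" "x k \<le> pi / 2" using d(1,2)[of k] \<delta> by (auto simp: x_def)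
    then show "AE s in lebesgue. 2 * \<bar>\<theta>\<bar> \<le> \<bar>s\<bar> \<and> 2 * x k \<le> \<bar>s\<bar> \<and> \<bar>s\<bar> \<le> pi
           \<longrightarrow> ennreal (norm (g (\<theta> - s))) \<le> radial_majorant g (x k)"
      by (rule AE_shifted_le_radial_majorant[OF per])
  qed
  then have "AE s in lebesgue. ennreal (norm (g (\<theta> - s))) * G s * indicator {s. 2 * \<bar>\<theta>\<bar> < \<bar>s\<bar> \<and> \<bar>s\<bar> \<le> \<delta>} s
      \<le> (\<Sum>k. radial_majorant g (x k) * (G s * indicator {-d k..d k} s))"
  proof eventually_elim
    case (elim s)
    show ?case
    proof (cases "2 * \<bar>\<theta>\<bar> < \<bar>s\<bar> \<and> \<bar>s\<bar> \<le> \<delta>")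
      case True
      then obtain k where k: "d k / 2 < \<bar>s\<bar>" "\<bar>s\<bar> \<le> d k"
        using dyadic_annulus[of s \<delta>] unfolding d_def by (metis abs_ge_zero abs_zero not_less zero_le_mult_iff zero_le_numeral)
      then have "ennreal (norm (g (\<theta> - s))) \<le> radial_majorant g (x k)"
        using elim True \<delta> by (auto simp: x_def)
      then have "ennreal (norm (g (\<theta> - s))) * G s \<le> radial_majorant g (x k) * (G s * indicator {-d k..d k} s)"
        using k by (auto simp: indicator_def intro!: mult_right_mono)
      also have "\<dots> \<le> (\<Sum>k. radial_majorant g (x k) * (G s * indicator {-d k..d k} s))"
        by (rule single)
      finally show ?thesis using True by simp
    qed auto
  qed
  then have "(\<integral>\<^sup>+ s\<in>{s. 2 * \<bar>\<theta>\<bar> < \<bar>s\<bar> \<and> \<bar>s\<bar> \<le> \<delta>}. ennreal (norm (g (\<theta> - s))) * G s \<partial>lebesgue)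
      \<le> (\<integral>\<^sup>+ s. (\<Sum>k. radial_majorant g (x k) * (G s * indicator {-d k..d k} s)) \<partial>lebesgue)"
    by (rule nn_integral_mono_AE)
  also have "\<dots> = (\<Sum>k. radial_majorant g (x k) * (\<integral>\<^sup>+ s\<in>{-d k..d k}. G s \<partial>lebesgue))"
    by (subst nn_integral_suminf) (measurable, simp add: nn_integral_cmult)
  also have "\<dots> \<le> (\<Sum>k. radial_majorant g (x k) * ennreal (\<epsilon> * d k))"
    using d by (intro suminf_le mult_left_mono small) auto
  also have "\<dots> = (\<Sum>k. ennreal (8 * \<epsilon>) * (radial_majorant g (x k) * emeasure lebesgue {x k / 2<..x k}))"
  proof (intro arg_cong[where f=suminf] ext)
    fix k
    have "emeasure lebesgue {x k / 2<..x k} = ennreal (d k / 8)" using d(1)[of k] by (simp add: x_def)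
    moreover have "ennreal (\<epsilon> * d k) = ennreal (8 * \<epsilon>) * ennreal (d k / 8)"
      using \<open>0 \<le> \<epsilon>\<close> d(1)[of k] by (simp add: ennreal_mult'[symmetric])
    ultimately show "radial_majorant g (x k) * ennreal (\<epsilon> * d k)
        = ennreal (8 * \<epsilon>) * (radial_majorant g (x k) * emeasure lebesgue {x k / 2<..x k})"
      by (simp only: mult.left_commute)
  qed
  also have "\<dots> = ennreal (8 * \<epsilon>) * (\<integral>\<^sup>+ t. (\<Sum>k. radial_majorant g (x k) * indicator {x k / 2<..x k} t) \<partial>lebesgue)"
    by (subst nn_integral_suminf) (measurable, simp add: nn_integral_cmult_indicator ennreal_suminf_cmult)
  also have "\<dots> \<le> ennreal (8 * \<epsilon>) * (\<integral>\<^sup>+ t. radial_majorant g t * indicator {-pi..pi} t \<partial>lebesgue)"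
  proof (intro mult_left_mono nn_integral_mono)
    fix t
    show "(\<Sum>k. radial_majorant g (x k) * indicator {x k / 2<..x k} t) \<le> radial_majorant g t * indicator {-pi..pi} t"
    proof (cases "\<exists>j. t \<in> {x j / 2<..x j}")
      case True
      then obtain j where j: "t \<in> {x j / 2<..x j}" ..
      have uniq: "k = j" if "t \<in> {x k / 2<..x k}" for k
      proof (rule ccontr)
        assume "k \<noteq> j"
        then consider "Suc k \<le> j" | "Suc j \<le> k" by linarith
        then show False using dec[of "Suc k" j] dec[of "Suc j" k] d(3)[of j] d(3)[of k] j that
          by cases (auto simp: x_def)
      qed
      have "(\<Sum>k. radial_majorant g (x k) * indicator {x k / 2<..x k} t)
          = (\<Sum>k\<in>{j}. radial_majorant g (x k) * indicator {x k / 2<..x k} t)"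
        using uniq by (intro suminf_finite) (auto simp: indicator_def)
      also have "\<dots> = radial_majorant g (x j)" using j by simp
      also have "\<dots> \<le> radial_majorant g t"
        using j d(1)[of j] by (intro radial_majorant_antimono g) (auto simp: x_def)
      finally show ?thesis using j d(1,2)[of j] \<delta> by (auto simp: x_def)
    next
      case False
      then have "(\<Sum>k. radial_majorant g (x k) * indicator {x k / 2<..x k} t) = (\<Sum>k::nat. 0)"
        by (intro arg_cong[where f=suminf] ext) (auto simp: indicator_def)
      then show ?thesis by simp
    qed
  qed simp
  also have "(\<integral>\<^sup>+ t. radial_majorant g t * indicator {-pi..pi} t \<partial>lebesgue) = (\<integral>\<^sup>+ t. radial_majorant g t \<partial>circle)"
    by (simp add: nn_integral_restrict_space)
  finally show ?thesis .
qed

section \<open>Approach rate and convergence\<close>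

lemma circle_LpD:
  assumes "g \<in> circle_Lp q"
  shows "periodic_fun_simple g (2 * pi)" "g \<in> borel_measurable circle" "g \<in> borel_measurable lebesgue"
    "circle_norm q g < \<infinity>"
  using assms periodic_borel_measurable by (auto simp: circle_Lp_def)

lemma approximate_identityD:
  assumes "approximate_identity \<phi>"
  shows "\<And>r. 0 < r \<Longrightarrow> r < 1 \<Longrightarrow> \<phi> r \<in> circle_Lp \<infinity>"
    and "((\<lambda>r. LINT t|circle. \<phi> r t) \<longlongrightarrow> 1) (at_left 1)"
    and "\<And>x. 0 < x \<Longrightarrow> x \<le> pi \<Longrightarrow> ((\<lambda>r. radial_majorant (\<phi> r) x) \<longlongrightarrow> 0) (at_left 1)"
    and "(SUP r\<in>{0<..<1}. \<integral>\<^sup>+ x. radial_majorant (\<phi> r) x \<partial>circle) < \<infinity>"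
  using assms by (simp_all add: approximate_identity_def)

lemma emeasure_circle: "emeasure circle {-pi..pi} = ennreal (2 * pi)"
  by (simp add: emeasure_restrict_space)

text \<open>
  The mass of \<open>\<phi> r\<close> is eventually larger than \<open>1 / 2\<close>, and outside \<open>[-\<delta>, \<delta>]\<close> the kernel
  is uniformly small.  Hence a fixed amount of mass sits on \<open>[-\<delta>, \<delta>]\<close>, which by Hoelder's
  inequality forces \<open>N powr p\<close> to be at least a constant divided by \<open>\<delta>\<close>.
\<close>

lemma approach_rate_tendsto_0:
  assumes \<phi>: "approximate_identity \<phi>" and p: "1 \<le> p"
  shows "(approach_rate \<phi> p \<longlongrightarrow> 0) (at_left 1)"
proof (rule tendstoI)
  fix \<epsilon> :: real assume \<epsilon>: "\<epsilon> > 0"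
  define \<delta> where "\<delta> = min (pi / 2) (\<epsilon> / (2 * 8 powr p))"
  have \<delta>: "0 < \<delta>" "\<delta> \<le> pi / 2" "\<delta> * 8 powr p < \<epsilon>"
    using \<epsilon> by (auto simp: \<delta>_def min_def field_simps)
  have "eventually (\<lambda>r. r \<in> {0<..<1::real}) (at_left 1)"
    by (auto simp: eventually_at_left_field intro!: exI[of _ 0])
  moreover have "eventually (\<lambda>r. radial_majorant (\<phi> r) \<delta> < ennreal (1 / (64 * pi))) (at_left 1)"
    using \<delta> by (intro order_tendstoD(2)[OF approximate_identityD(3)[OF \<phi>]]) auto
  moreover have "eventually (\<lambda>r. norm (LINT t|circle. \<phi> r t) > 1 / 2) (at_left 1)"
    by (rule order_tendstoD(1)[OF tendsto_norm[OF approximate_identityD(2)[OF \<phi>]]]) simp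
  ultimately show "eventually (\<lambda>r. dist (approach_rate \<phi> p r) 0 < \<epsilon>) (at_left 1)"
  proof eventually_elim
    case (elim r)
    have gL: "\<phi> r \<in> circle_Lp \<infinity>" using elim(1) by (intro approximate_identityD(1)[OF \<phi>]) auto
    note g = circle_LpD[OF gL]
    note [measurable] = g(2,3)
    have [measurable]: "{-\<delta>..\<delta>} \<in> sets lebesgue" by simp
    define N where "N = enn2real (circle_norm (conj_exponent p) (\<phi> r))"
    have rate: "approach_rate \<phi> p r = N powr (- p)" by (simp add: approach_rate_def N_def)
    show ?case
    proof (cases "N = 0")
      case True
      then show ?thesis using \<epsilon> by (simp add: rate)
    next
      case False
      then have "N > 0" by (simp add: N_def order_less_le)
      have vm: "indicator {-\<delta>..\<delta>} \<in> borel_measurable circle"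
        by (intro measurable_restrict_space1) measurable
      have big: "AE t in circle. ennreal (norm (\<phi> r t)) \<le> ennreal (norm (\<phi> r t) * indicator {-\<delta>..\<delta>} t) + ennreal (1 / (64 * pi))"
      proof -
        have "AE t in lebesgue. \<delta> \<le> \<bar>t\<bar> \<and> \<bar>t\<bar> \<le> 2 * pi - \<delta> \<longrightarrow> ennreal (norm (\<phi> r t)) \<le> radial_majorant (\<phi> r) \<delta>"
          by (rule AE_le_radial_majorant[OF g(1) \<delta>(1)])
        then have "AE t in lebesgue. t \<in> {-pi..pi} \<longrightarrow> ennreal (norm (\<phi> r t)) \<le> ennreal (norm (\<phi> r t) * indicator {-\<delta>..\<delta>} t) + ennreal (1 / (64 * pi))"
        proof eventually_elim
          case (elim t)
          show ?case
          proof (cases "\<bar>t\<bar> \<le> \<delta>")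
            case True then show ?thesis by (auto simp: indicator_def add_increasing2)
          next
            case False
            show ?thesis
            proof
              assume "t \<in> {-pi..pi}"
              then have "ennreal (norm (\<phi> r t)) \<le> radial_majorant (\<phi> r) \<delta>"
                using elim False \<delta> by auto
              also note less_imp_le[OF \<open>radial_majorant (\<phi> r) \<delta> < ennreal (1 / (64 * pi))\<close>]
              finally show "ennreal (norm (\<phi> r t)) \<le> ennreal (norm (\<phi> r t) * indicator {-\<delta>..\<delta>} t) + ennreal (1 / (64 * pi))"
                by (simp add: add_increasing)
            qed
          qed
        qed
        then show ?thesis by (simp add: AE_restrict_space_iff)
      qed
      have nm: "(\<lambda>t. ennreal (norm (\<phi> r t) * indicator {-\<delta>..\<delta>} t)) \<in> borel_measurable circle"
        by (intro measurable_restrict_space1) measurable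
      have "ennreal (1 / 2) \<le> ennreal (norm (LINT t|circle. \<phi> r t))"
        using elim(3) by (intro ennreal_leI) simp
      also have "\<dots> \<le> (\<integral>\<^sup>+ t. ennreal (norm (\<phi> r t)) \<partial>circle)"
      proof (cases "integrable circle (\<phi> r)")
        case True
        then show ?thesis by (rule integral_norm_bound_ennreal)
      qed (simp add: not_integrable_integral_eq)
      also have "\<dots> \<le> (\<integral>\<^sup>+ t. ennreal (norm (\<phi> r t) * indicator {-\<delta>..\<delta>} t) + ennreal (1 / (64 * pi)) \<partial>circle)"
        by (rule nn_integral_mono_AE[OF big])
      also have "\<dots> = (\<integral>\<^sup>+ t. ennreal (norm (\<phi> r t) * indicator {-\<delta>..\<delta>} t) \<partial>circle) + ennreal (1 / (64 * pi)) * ennreal (2 * pi)"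
        by (subst nn_integral_add[OF nm]) (simp_all add: emeasure_circle)
      also have "ennreal (1 / (64 * pi)) * ennreal (2 * pi) = ennreal (1 / 32)"
        by (simp add: ennreal_mult'[symmetric])
      also have "(\<integral>\<^sup>+ t. ennreal (norm (\<phi> r t) * indicator {-\<delta>..\<delta>} t) \<partial>circle)
          \<le> ennreal (1 / 8) + ennreal ((1 / 8) powr (1 - p) * N powr p) * (\<integral>\<^sup>+ t. ennreal (indicator {-\<delta>..\<delta>} t powr p) \<partial>circle)"
        by (rule nn_integral_norm_mult_le[OF p _ g(2) vm _ N_def \<open>N > 0\<close>]) auto
      also have "(\<integral>\<^sup>+ t. ennreal (indicator {-\<delta>..\<delta>} t powr p) \<partial>circle) \<le> ennreal (2 * \<delta>)"
      proof -
        have "(\<integral>\<^sup>+ t. ennreal (indicator {-\<delta>..\<delta>} t powr p) \<partial>circle) \<le> (\<integral>\<^sup>+ t. indicator {-\<delta>..\<delta>} t \<partial>lebesgue)"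
          by (subst nn_integral_restrict_space, simp) (intro nn_integral_mono, auto simp: indicator_def)
        also have "\<dots> = ennreal (2 * \<delta>)" using \<delta> by simp
        finally show ?thesis .
      qed
      finally have "ennreal (1 / 2) \<le> ennreal (1 / 8) + ennreal ((1 / 8) powr (1 - p) * N powr p) * ennreal (2 * \<delta>) + ennreal (1 / 32)"
        by (simp add: add_mono mult_left_mono)
      then have "ennreal (1 / 2) \<le> ennreal (1 / 8 + (1 / 8) powr (1 - p) * N powr p * (2 * \<delta>) + 1 / 32)"
        using \<delta> by (simp add: ennreal_mult'[symmetric] ennreal_plus[symmetric] del: ennreal_plus)
      then have "1 / 2 \<le> 1 / 8 + (1 / 8) powr (1 - p) * N powr p * (2 * \<delta>) + 1 / 32"
        using \<delta> by (subst (asm) ennreal_le_iff) auto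
      moreover have "(1 / 8 :: real) powr (1 - p) = 8 powr p / 8"
        by (simp add: powr_divide powr_diff)
      ultimately have "1 \<le> 8 powr p * N powr p * \<delta>" by (simp add: field_simps)
      then have "N powr (- p) \<le> \<delta> * 8 powr p"
        using \<open>N > 0\<close> by (simp add: powr_minus_divide divide_le_eq mult_ac)
      then show ?thesis using \<delta>(3) by (simp add: rate)
    qed
  qed
qed

lemma integrable_bounded_mult:
  fixes g f :: "real \<Rightarrow> 'a::{real_normed_field, euclidean_space}"
  assumes g [measurable]: "g \<in> borel_measurable circle" and bd: "circle_norm \<infinity> g < \<infinity>"
    and f: "integrable circle f"
  shows "integrable circle (\<lambda>t. g t * f t)"
proof (rule integrableI_bounded)
  define E where "E = esssup circle (\<lambda>t. ennreal (norm (g t)))"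
  have E: "E < \<infinity>" using bd by (simp add: circle_norm_def E_def)
  note [measurable] = borel_measurable_integrable[OF f]
  show "(\<lambda>t. g t * f t) \<in> borel_measurable circle" by measurable
  have "AE t in circle. ennreal (norm (g t * f t)) \<le> E * ennreal (norm (f t))"
    using esssup_AE[where M=circle and f="\<lambda>t. ennreal (norm (g t))"]
    by eventually_elim (auto simp: E_def norm_mult ennreal_mult' intro!: mult_right_mono)
  then have "(\<integral>\<^sup>+ t. ennreal (norm (g t * f t)) \<partial>circle) \<le> (\<integral>\<^sup>+ t. E * ennreal (norm (f t)) \<partial>circle)"
    by (rule nn_integral_mono_AE)
  also have "\<dots> = E * (\<integral>\<^sup>+ t. ennreal (norm (f t)) \<partial>circle)"
    by (rule nn_integral_cmult) measurable
  also have "\<dots> < \<infinity>"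
    using E f by (auto simp: ennreal_mult_less_top integrable_iff_bounded)
  finally show "(\<integral>\<^sup>+ t. ennreal (norm (g t * f t)) \<partial>circle) < \<infinity>" .
qed

lemma circle_Lp_powr_finite:
  assumes f: "f \<in> circle_Lp (ennreal p)" and p: "0 < s" "s \<le> p"
  shows "(\<integral>\<^sup>+ t. ennreal (norm (f t) powr s) \<partial>circle) < \<infinity>"
proof -
  note [measurable] = circle_LpD(2)[OF f]
  have fin: "(\<integral>\<^sup>+ t. ennreal (norm (f t) powr p) \<partial>circle) < \<infinity>"
    using circle_LpD(4)[OF f] p by (auto simp: circle_norm_def Let_def less_top split: if_splits)
  have "(\<integral>\<^sup>+ t. ennreal (norm (f t) powr s) \<partial>circle) \<le> (\<integral>\<^sup>+ t. 1 + ennreal (norm (f t) powr p) \<partial>circle)"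
  proof (rule nn_integral_mono)
    fix t
    have "norm (f t) powr s \<le> 1 + norm (f t) powr p"
    proof (cases "norm (f t) \<le> 1")
      case True
      then have "norm (f t) powr s \<le> 1 powr s" using p by (intro powr_mono2) auto
      then show ?thesis by (simp add: add_increasing2)
    next
      case False
      then have "norm (f t) powr s \<le> norm (f t) powr p" using p by (intro powr_mono) auto
      then show ?thesis by simp
    qed
    then have "ennreal (norm (f t) powr s) \<le> ennreal (1 + norm (f t) powr p)" by (rule ennreal_leI)
    then show "ennreal (norm (f t) powr s) \<le> 1 + ennreal (norm (f t) powr p)" by simp
  qed
  also have "\<dots> = ennreal (2 * pi) + (\<integral>\<^sup>+ t. ennreal (norm (f t) powr p) \<partial>circle)"
    by (subst nn_integral_add) (auto simp: emeasure_circle)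
  also have "\<dots> < \<infinity>" using fin by simp
  finally show ?thesis .
qed

lemma circle_Lp_integrable:
  assumes f: "f \<in> circle_Lp (ennreal p)" and p: "1 \<le> p"
  shows "integrable circle f"
  using circle_Lp_powr_finite[OF f, of 1] circle_LpD(2)[OF f] p
  by (simp add: integrable_iff_bounded)

text \<open>
  The decomposition \<open>f t = (f t - w) + w\<close>; by rotation invariance the constant \<open>w\<close> meets the
  integral of \<open>\<phi> r\<close> itself, whatever \<open>y\<close> is.  This makes the second term uniform in \<open>\<theta>\<close>.
\<close>

lemma norm_kernel_op_diff_le:
  fixes \<phi> :: "real \<Rightarrow> real \<Rightarrow> 'a::{real_normed_field, euclidean_space}"
  assumes g: "\<phi> r \<in> circle_Lp \<infinity>" and f: "integrable circle f"
  shows "ennreal (norm (kernel_op \<phi> r y f - w))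
    \<le> (\<integral>\<^sup>+ t. ennreal (norm (\<phi> r (y - t)) * norm (f t - w)) \<partial>circle)
       + ennreal (norm ((LINT t|circle. \<phi> r t) - 1) * norm w)"
proof -
  let ?g = "\<lambda>t. \<phi> r (y - t)"
  note per = circle_LpD(1)[OF g] and m = circle_LpD(3)[OF g]
  have gm: "?g \<in> borel_measurable circle"
    by (rule distr_circle_rotate_reflect(1)[OF per m])
  have gb: "circle_norm \<infinity> ?g < \<infinity>"
    using circle_LpD(4)[OF g] by (simp add: circle_norm_rotate_reflect[OF per m])
  have const: "integrable circle (\<lambda>t. w)"
    by (rule finite_measure.integrable_const)
       (auto intro!: finite_measureI simp: emeasure_circle)
  have fw: "integrable circle (\<lambda>t. f t - w)" using f const by (rule Bochner_Integration.integrable_diff)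
  have 1: "integrable circle (\<lambda>t. ?g t * (f t - w))" by (rule integrable_bounded_mult[OF gm gb fw])
  have 2: "integrable circle (\<lambda>t. ?g t * w)" by (rule integrable_bounded_mult[OF gm gb const])
  have "kernel_op \<phi> r y f = (LINT t|circle. ?g t * (f t - w) + ?g t * w)"
    by (simp add: kernel_op_def algebra_simps)
  also have "\<dots> = (LINT t|circle. ?g t * (f t - w)) + (LINT t|circle. ?g t * w)"
    using 1 2 by (rule Bochner_Integration.integral_add)
  also have "(LINT t|circle. ?g t * w) = (LINT t|circle. ?g t) * w"
    by simp
  also have "(LINT t|circle. ?g t) = (LINT t|circle. \<phi> r t)"
    by (rule integral_circle_rotate_reflect(2)[OF per m])
  finally have "kernel_op \<phi> r y f - w = (LINT t|circle. ?g t * (f t - w)) + ((LINT t|circle. \<phi> r t) - 1) * w"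
    by (simp add: algebra_simps)
  then have "norm (kernel_op \<phi> r y f - w) \<le> norm (LINT t|circle. ?g t * (f t - w)) + norm (((LINT t|circle. \<phi> r t) - 1) * w)"
    by (metis norm_triangle_ineq)
  then have "ennreal (norm (kernel_op \<phi> r y f - w)) \<le> ennreal (norm (LINT t|circle. ?g t * (f t - w))) + ennreal (norm ((LINT t|circle. \<phi> r t) - 1) * norm w)"
    by (simp add: ennreal_plus[symmetric] ennreal_leI norm_mult del: ennreal_plus)
  also have "ennreal (norm (LINT t|circle. ?g t * (f t - w))) \<le> (\<integral>\<^sup>+ t. ennreal (norm (?g t * (f t - w))) \<partial>circle)"
    by (rule integral_norm_bound_ennreal[OF 1])
  finally show ?thesis by (simp add: norm_mult)
qed

lemma circle_lebesgue_points:
  assumes f: "f \<in> circle_Lp (ennreal p)" and p: "0 < s" "s \<le> p"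
  shows "AE x in circle. \<forall>\<epsilon>>0. \<exists>d>0. \<forall>h. 0 < h \<and> h \<le> d \<longrightarrow>
      (\<integral>\<^sup>+ u\<in>{-h..h}. ennreal (norm (f (x + u) - f x) powr s) \<partial>lebesgue) \<le> ennreal (\<epsilon> * h)"
proof -
  let ?S = "{-pi<..<pi}"
  note [measurable] = circle_LpD(3)[OF f]
  have "(\<integral>\<^sup>+ t\<in>?S. ennreal (norm (f t) powr s) \<partial>lebesgue) \<le> (\<integral>\<^sup>+ t. ennreal (norm (f t) powr s) \<partial>circle)"
    by (simp add: nn_integral_restrict_space) (intro nn_integral_mono, auto simp: indicator_def)
  also note circle_Lp_powr_finite[OF f p]
  finally have fin: "(\<integral>\<^sup>+ t\<in>?S. ennreal (norm (f t) powr s) \<partial>lebesgue) < \<infinity>" .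
  have ends: "{-pi, pi} \<in> null_sets lebesgue"
    by (intro null_sets_completionI finite_imp_null_set_lborel) simp
  have Sm: "?S \<in> lmeasurable" by (rule lmeasurable_interval)
  have "AE x in lebesgue. x \<in> {-pi..pi} \<longrightarrow> (\<forall>\<epsilon>>0. \<exists>d>0. \<forall>h. 0 < h \<and> h \<le> d \<longrightarrow>
      (\<integral>\<^sup>+ u\<in>{-h..h}. ennreal (norm (f (x + u) - f x) powr s) \<partial>lebesgue) \<le> ennreal (\<epsilon> * h))"
    using lebesgue_points[OF circle_LpD(3)[OF f] p(1) open_greaterThanLessThan Sm fin] AE_not_in[OF ends]
  proof (eventually_elim, intro impI allI)
    fix x \<epsilon> :: real
    assume *: "x \<in> ?S \<longrightarrow> (\<forall>\<epsilon>>0. \<exists>d>0. \<forall>h. 0 < h \<and> h \<le> d \<longrightarrow>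
        (\<integral>\<^sup>+ y\<in>cball x h. ennreal (norm (f y - f x) powr s) \<partial>lebesgue) \<le> ennreal \<epsilon> * emeasure lebesgue (cball x h))"
      and x: "x \<notin> {-pi, pi}" "x \<in> {-pi..pi}" and \<epsilon>: "\<epsilon> > 0"
    have "x \<in> ?S" using x by auto
    moreover have "\<epsilon> / 2 > 0" using \<epsilon> by simp
    ultimately obtain d where d: "d > 0" and le: "\<forall>h. 0 < h \<and> h \<le> d \<longrightarrow>
        (\<integral>\<^sup>+ y\<in>cball x h. ennreal (norm (f y - f x) powr s) \<partial>lebesgue) \<le> ennreal (\<epsilon> / 2) * emeasure lebesgue (cball x h)"
      using * by blast
    show "\<exists>d>0. \<forall>h. 0 < h \<and> h \<le> d \<longrightarrow>
      (\<integral>\<^sup>+ u\<in>{-h..h}. ennreal (norm (f (x + u) - f x) powr s) \<partial>lebesgue) \<le> ennreal (\<epsilon> * h)"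
    proof (intro exI[of _ d] conjI allI impI d)
      fix h assume h: "0 < h \<and> h \<le> d"
      have [measurable]: "cball x h \<in> sets lebesgue" by (simp add: borel_closed)
      have m: "(\<lambda>y. ennreal (norm (f y - f x) powr s) * indicator (cball x h) y) \<in> borel_measurable lebesgue"
        by measurable
      have "(\<integral>\<^sup>+ u\<in>{-h..h}. ennreal (norm (f (x + u) - f x) powr s) \<partial>lebesgue)
          = (\<integral>\<^sup>+ u. ennreal (norm (f (x + u) - f x) powr s) * indicator (cball x h) (x + u) \<partial>lebesgue)"
        by (intro nn_integral_cong) (auto simp: indicator_def dist_norm)
      also have "\<dots> = (\<integral>\<^sup>+ y\<in>cball x h. ennreal (norm (f y - f x) powr s) \<partial>lebesgue)"
        using nn_integral_real_affine_lebesgue[OF m, of 1 x] by simp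
      also have "\<dots> \<le> ennreal (\<epsilon> / 2) * emeasure lebesgue (cball x h)" using le h by blast
      also have "\<dots> = ennreal (\<epsilon> * h)"
        using h \<epsilon> by (simp add: cball_eq_atLeastAtMost ennreal_mult'[symmetric])
      finally show "(\<integral>\<^sup>+ u\<in>{-h..h}. ennreal (norm (f (x + u) - f x) powr s) \<partial>lebesgue) \<le> ennreal (\<epsilon> * h)" .
    qed
  qed
  then show ?thesis by (simp add: AE_restrict_space_iff)
qed

text \<open>
  The four terms on the right are, in order, the two from Young's inequality on
  \<open>\<bar>s\<bar> \<le> 2 * a\<close>, the annuli \<open>2 * a < \<bar>s\<bar> \<le> \<delta>\<close>, and the remaining part \<open>\<bar>s\<bar> > \<delta>\<close>.
\<close>

lemma kernel_estimate:
  fixes g f :: "real \<Rightarrow> 'a::{real_normed_field, euclidean_space}"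
  assumes p: "1 \<le> p" and \<eta>: "0 < \<eta>"
    and g: "periodic_fun_simple g (2 * pi)" "g \<in> borel_measurable lebesgue"
    and f: "periodic_fun_simple f (2 * pi)" "f \<in> borel_measurable lebesgue"
    and N: "N = enn2real (circle_norm (conj_exponent p) g)" "0 < N"
    and \<theta>: "\<bar>\<theta>\<bar> < a" "2 * a \<le> \<delta>" "\<delta> \<le> pi" and "0 \<le> \<epsilon>"
    and small_p: "(\<integral>\<^sup>+ s\<in>{-(2*a)..2*a}. ennreal (norm (f (x + s) - f x) powr p) \<partial>lebesgue) \<le> ennreal (\<epsilon> * (2 * a))"
    and small_1: "\<And>h. 0 < h \<Longrightarrow> h \<le> \<delta> \<Longrightarrow> (\<integral>\<^sup>+ s\<in>{-h..h}. ennreal (norm (f (x + s) - f x)) \<partial>lebesgue) \<le> ennreal (\<epsilon> * h)"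
  shows "(\<integral>\<^sup>+ t. ennreal (norm (g (x + \<theta> - t)) * norm (f t - f x)) \<partial>circle)
    \<le> ennreal \<eta> + ennreal (\<eta> powr (1 - p) * N powr p) * ennreal (\<epsilon> * (2 * a))
      + ennreal (8 * \<epsilon>) * (\<integral>\<^sup>+ u. radial_majorant g u \<partial>circle)
      + radial_majorant g (\<delta> / 2) * (\<integral>\<^sup>+ t. ennreal (norm (f t - f x)) \<partial>circle)"
proof -
  interpret g: periodic_fun_simple g "2 * pi" by fact
  interpret f: periodic_fun_simple f "2 * pi" by fact
  note [measurable] = g(2) f(2)
  have [measurable]: "{-h..h} \<in> sets lebesgue" for h :: real by simp
  have \<delta>: "0 < \<delta>" using \<theta> by linarith
  define G where "G s = norm (f (x + s) - f x)" for s
  define R where "R = {s. 2 * \<bar>\<theta>\<bar> < \<bar>s\<bar> \<and> \<bar>s\<bar> \<le> \<delta>}"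
  have R [measurable]: "R \<in> sets lebesgue"
  proof -
    have "R \<in> sets borel" unfolding R_def by measurable
    then show ?thesis by simp
  qed
  have tm: "(\<lambda>t. z + t) \<in> lebesgue \<rightarrow>\<^sub>M lebesgue" "(\<lambda>t. z - t) \<in> lebesgue \<rightarrow>\<^sub>M lebesgue" for z :: real
    using translate_reflect_measurable[of 1 z] translate_reflect_measurable[of "-1" z] by simp_all
  note [measurable] = measurable_compose[OF tm(1) f(2)] measurable_compose[OF tm(2) g(2)]
  have Gm [measurable]: "G \<in> borel_measurable lebesgue" unfolding G_def by measurable
  have Gc [measurable]: "G \<in> borel_measurable circle" by (intro measurable_restrict_space1) measurable
  have gc [measurable]: "(\<lambda>s. g (\<theta> - s)) \<in> borel_measurable circle" by (intro measurable_restrict_space1) measurable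
  define v where "v s = G s * indicator {-(2*a)..2*a} s" for s
  have vc [measurable]: "v \<in> borel_measurable circle"
    unfolding v_def by (intro measurable_restrict_space1) measurable
  have v0: "0 \<le> v s" for s by (simp add: v_def G_def)
  have t1: "(\<lambda>s. ennreal (norm (g (\<theta> - s)) * v s)) \<in> borel_measurable circle"
    unfolding v_def by (intro measurable_restrict_space1) measurable
  have t3: "(\<lambda>s. radial_majorant g (\<delta> / 2) * ennreal (G s)) \<in> borel_measurable circle"
    by (intro measurable_restrict_space1) measurable
  have Rc: "(\<lambda>s. ennreal (norm (g (\<theta> - s))) * ennreal (G s) * indicator R s) \<in> borel_measurable circle"
    by (intro measurable_restrict_space1) measurable
  have "(\<integral>\<^sup>+ t. ennreal (norm (g (x + \<theta> - t)) * norm (f t - f x)) \<partial>circle)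
      = (\<integral>\<^sup>+ s. ennreal (norm (g (x + \<theta> - (x + s))) * norm (f (x + s) - f x)) \<partial>circle)"
  proof (rule nn_integral_circle_translate[symmetric])
    show "periodic_fun_simple (\<lambda>t. ennreal (norm (g (x + \<theta> - t)) * norm (f t - f x))) (2 * pi)"
      using g.minus_1 f.plus_1 by (simp add: periodic_fun_simple_def diff_diff_eq[symmetric])
  qed measurable
  also have "\<dots> = (\<integral>\<^sup>+ s. ennreal (norm (g (\<theta> - s)) * G s) \<partial>circle)"
    by (simp add: G_def)
  also have "\<dots> \<le> (\<integral>\<^sup>+ s. (ennreal (norm (g (\<theta> - s)) * v s) + ennreal (norm (g (\<theta> - s))) * ennreal (G s) * indicator R s)
      + radial_majorant g (\<delta> / 2) * ennreal (G s) \<partial>circle)"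
  proof (rule nn_integral_mono_AE)
    have "AE s in lebesgue. 2 * \<bar>\<theta>\<bar> \<le> \<bar>s\<bar> \<and> 2 * (\<delta> / 2) \<le> \<bar>s\<bar> \<and> \<bar>s\<bar> \<le> pi
           \<longrightarrow> ennreal (norm (g (\<theta> - s))) \<le> radial_majorant g (\<delta> / 2)"
      using \<delta> \<theta> by (intro AE_shifted_le_radial_majorant[OF g(1)]) auto
    then have "AE s in lebesgue. s \<in> {-pi..pi} \<longrightarrow> ennreal (norm (g (\<theta> - s)) * G s) \<le>
       (ennreal (norm (g (\<theta> - s)) * v s) + ennreal (norm (g (\<theta> - s))) * ennreal (G s) * indicator R s)
        + radial_majorant g (\<delta> / 2) * ennreal (G s)"
    proof (eventually_elim, intro impI)
      fix s
      assume *: "2 * \<bar>\<theta>\<bar> \<le> \<bar>s\<bar> \<and> 2 * (\<delta> / 2) \<le> \<bar>s\<bar> \<and> \<bar>s\<bar> \<le> pi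
           \<longrightarrow> ennreal (norm (g (\<theta> - s))) \<le> radial_majorant g (\<delta> / 2)" and s: "s \<in> {-pi..pi}"
      have G0: "0 \<le> G s" by (simp add: G_def)
      consider "\<bar>s\<bar> \<le> 2 * a" | "2 * a < \<bar>s\<bar>" "\<bar>s\<bar> \<le> \<delta>" | "\<delta> < \<bar>s\<bar>" by linarith
      then show "ennreal (norm (g (\<theta> - s)) * G s) \<le>
       (ennreal (norm (g (\<theta> - s)) * v s) + ennreal (norm (g (\<theta> - s))) * ennreal (G s) * indicator R s)
        + radial_majorant g (\<delta> / 2) * ennreal (G s)"
      proof cases
        case 1
        then have "v s = G s" by (auto simp: v_def indicator_def)
        then show ?thesis by (simp add: add_increasing2)
      next
        case 2
        then have "s \<in> R" using \<theta> by (auto simp: R_def)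
        then show ?thesis using G0 by (simp add: add_increasing add_increasing2 ennreal_mult')
      next
        case 3
        then have "ennreal (norm (g (\<theta> - s))) \<le> radial_majorant g (\<delta> / 2)"
          using * s \<theta> by auto
        then have "ennreal (norm (g (\<theta> - s))) * ennreal (G s) \<le> radial_majorant g (\<delta> / 2) * ennreal (G s)"
          by (rule mult_right_mono) simp
        then show ?thesis by (simp add: add_increasing ennreal_mult')
      qed
    qed
    then show "AE s in circle. ennreal (norm (g (\<theta> - s)) * G s) \<le>
       (ennreal (norm (g (\<theta> - s)) * v s) + ennreal (norm (g (\<theta> - s))) * ennreal (G s) * indicator R s)
        + radial_majorant g (\<delta> / 2) * ennreal (G s)"
      by (simp add: AE_restrict_space_iff)
  qed
  also have "\<dots> = (\<integral>\<^sup>+ s. ennreal (norm (g (\<theta> - s)) * v s) \<partial>circle)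
      + (\<integral>\<^sup>+ s. ennreal (norm (g (\<theta> - s))) * ennreal (G s) * indicator R s \<partial>circle)
      + (\<integral>\<^sup>+ s. radial_majorant g (\<delta> / 2) * ennreal (G s) \<partial>circle)"
    by (simp only: nn_integral_add[OF borel_measurable_add[OF t1 Rc] t3] nn_integral_add[OF t1 Rc])
  also have "(\<integral>\<^sup>+ s. ennreal (norm (g (\<theta> - s)) * v s) \<partial>circle)
      \<le> ennreal \<eta> + ennreal (\<eta> powr (1 - p) * N powr p) * (\<integral>\<^sup>+ s. ennreal (v s powr p) \<partial>circle)"
    using N by (intro nn_integral_norm_mult_le p \<eta> gc vc v0) (simp_all add: circle_norm_rotate_reflect[OF g])
  also have "(\<integral>\<^sup>+ s. ennreal (v s powr p) \<partial>circle) \<le> ennreal (\<epsilon> * (2 * a))"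
  proof -
    have "(\<integral>\<^sup>+ s. ennreal (v s powr p) \<partial>circle)
        \<le> (\<integral>\<^sup>+ s\<in>{-(2*a)..2*a}. ennreal (norm (f (x + s) - f x) powr p) \<partial>lebesgue)"
      using p by (simp add: nn_integral_restrict_space)
         (intro nn_integral_mono, auto simp: v_def G_def indicator_def)
    then show ?thesis using small_p by (rule order_trans)
  qed
  also have "(\<integral>\<^sup>+ s. ennreal (norm (g (\<theta> - s))) * ennreal (G s) * indicator R s \<partial>circle)
      \<le> ennreal (8 * \<epsilon>) * (\<integral>\<^sup>+ u. radial_majorant g u \<partial>circle)"
  proof -
    have "(\<integral>\<^sup>+ s. ennreal (norm (g (\<theta> - s))) * ennreal (G s) * indicator R s \<partial>circle)
        \<le> (\<integral>\<^sup>+ s\<in>R. ennreal (norm (g (\<theta> - s))) * ennreal (G s) \<partial>lebesgue)"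
      by (simp add: nn_integral_restrict_space) (intro nn_integral_mono, auto simp: indicator_def)
    also have "\<dots> \<le> ennreal (8 * \<epsilon>) * (\<integral>\<^sup>+ u. radial_majorant g u \<partial>circle)"
      unfolding R_def
      by (rule annuli_estimate[OF g _ \<delta> \<open>\<delta> \<le> pi\<close> \<open>0 \<le> \<epsilon>\<close>]) (use small_1 in \<open>auto simp: G_def\<close>)
    finally show ?thesis .
  qed
  also have "(\<integral>\<^sup>+ s. radial_majorant g (\<delta> / 2) * ennreal (G s) \<partial>circle)
      = radial_majorant g (\<delta> / 2) * (\<integral>\<^sup>+ t. ennreal (norm (f t - f x)) \<partial>circle)"
  proof -
    have "(\<integral>\<^sup>+ s. radial_majorant g (\<delta> / 2) * ennreal (G s) \<partial>circle)
        = radial_majorant g (\<delta> / 2) * (\<integral>\<^sup>+ s. ennreal (G s) \<partial>circle)"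
      by (rule nn_integral_cmult) measurable
    also have "(\<integral>\<^sup>+ s. ennreal (G s) \<partial>circle) = (\<integral>\<^sup>+ t. ennreal (norm (f t - f x)) \<partial>circle)"
      unfolding G_def
      by (rule nn_integral_circle_translate[where F="\<lambda>t. ennreal (norm (f t - f x))"])
         (auto simp: periodic_fun_simple_def f.plus_1)
    finally show ?thesis .
  qed
  finally show ?thesis by (simp add: add_mono mult_left_mono)
qed

theorem mainTheorem4:
  fixes \<phi> :: "real \<Rightarrow> real \<Rightarrow> 'a::{real_normed_field, euclidean_space}"
    and f :: "real \<Rightarrow> 'a"
    and p c :: real
  assumes "approximate_identity \<phi>"
    and "1 \<le> p"
    and "0 < c"
    and "f \<in> circle_Lp (ennreal p)"
  shows "AE x in circle.
           ((\<lambda>r. SUP \<theta>\<in>{\<theta>. \<bar>\<theta>\<bar> < c * approach_rate \<phi> p r}.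
                   ennreal (norm (kernel_op \<phi> r (x + \<theta>) f - f x))) \<longlongrightarrow> 0) (at_left 1)"
proof -
  note \<phi> = approximate_identityD[OF assms(1)] and p = assms(2) and c = assms(3) and f = assms(4)
  note fint = circle_Lp_integrable[OF f p]
  obtain C where C: "0 \<le> C" "(SUP r\<in>{0<..<1}. \<integral>\<^sup>+ x. radial_majorant (\<phi> r) x \<partial>circle) = ennreal C"
    using \<phi>(4) by (metis ennreal_cases less_irrefl infinity_ennreal_def)
  have majorant: "(\<integral>\<^sup>+ x. radial_majorant (\<phi> r) x \<partial>circle) \<le> ennreal C" if "0 < r" "r < 1" for r
    unfolding C(2)[symmetric] using that by (intro SUP_upper) auto
  have "AE x in circle. \<forall>\<epsilon>>0. \<exists>d>0. \<forall>h. 0 < h \<and> h \<le> d \<longrightarrow>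
      (\<integral>\<^sup>+ u\<in>{-h..h}. ennreal (norm (f (x + u) - f x) powr p) \<partial>lebesgue) \<le> ennreal (\<epsilon> * h)"
    using p by (intro circle_lebesgue_points[OF f]) auto
  moreover have "AE x in circle. \<forall>\<epsilon>>0. \<exists>d>0. \<forall>h. 0 < h \<and> h \<le> d \<longrightarrow>
      (\<integral>\<^sup>+ u\<in>{-h..h}. ennreal (norm (f (x + u) - f x) powr 1) \<partial>lebesgue) \<le> ennreal (\<epsilon> * h)"
    using p by (intro circle_lebesgue_points[OF f]) auto
  ultimately show ?thesis
  proof eventually_elim
    case (elim x)
    have const: "integrable circle (\<lambda>t. f x)"
      by (rule finite_measure.integrable_const)
         (auto intro!: finite_measureI simp: emeasure_circle)
    have "(\<integral>\<^sup>+ t. ennreal (norm (f t - f x)) \<partial>circle) < \<infinity>"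
      using Bochner_Integration.integrable_diff[OF fint const] by (simp add: integrable_iff_bounded)
    then obtain m where m: "0 \<le> m" "(\<integral>\<^sup>+ t. ennreal (norm (f t - f x)) \<partial>circle) = ennreal m"
      by (metis ennreal_cases less_irrefl infinity_ennreal_def)
    let ?S = "\<lambda>r. SUP \<theta>\<in>{\<theta>. \<bar>\<theta>\<bar> < c * approach_rate \<phi> p r}.
                   ennreal (norm (kernel_op \<phi> r (x + \<theta>) f - f x))"
    have main: "eventually (\<lambda>r. ?S r \<le> ennreal e) (at_left 1)" if e: "e > 0" for e :: real
    proof -
      define \<eta> where "\<eta> = e / 5"
      have \<eta>: "\<eta> > 0" using e by (simp add: \<eta>_def)
      define K where "K = \<eta> powr (1 - p) * (2 * c)"
      have K: "K > 0" using \<eta> c by (simp add: K_def)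
      \<comment> \<open>One choice makes both the near part, \<open>K * \<epsilon>\<close>, and the annuli, \<open>8 * \<epsilon> * C\<close>, at most \<open>\<eta>\<close>.\<close>
      define \<epsilon> where "\<epsilon> = \<eta> / (K + 8 * C + 1)"
      have \<epsilon>: "\<epsilon> > 0" "K * \<epsilon> \<le> \<eta>" "8 * \<epsilon> * C \<le> \<eta>"
        using K C(1) \<eta> by (auto simp: \<epsilon>_def divide_simps algebra_simps)
      obtain d1 where d1: "d1 > 0" and small_p: "\<And>h. 0 < h \<Longrightarrow> h \<le> d1 \<Longrightarrow>
          (\<integral>\<^sup>+ u\<in>{-h..h}. ennreal (norm (f (x + u) - f x) powr p) \<partial>lebesgue) \<le> ennreal (\<epsilon> * h)"
        using elim(1)[THEN spec, of \<epsilon>] \<epsilon>(1) by auto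
      obtain d2 where d2: "d2 > 0" and small_1: "\<And>h. 0 < h \<Longrightarrow> h \<le> d2 \<Longrightarrow>
          (\<integral>\<^sup>+ u\<in>{-h..h}. ennreal (norm (f (x + u) - f x)) \<partial>lebesgue) \<le> ennreal (\<epsilon> * h)"
        using elim(2)[THEN spec, of \<epsilon>] \<epsilon>(1) by auto
      define \<delta> where "\<delta> = min pi (min d1 d2)"
      have \<delta>: "0 < \<delta>" "\<delta> \<le> pi" "\<delta> \<le> d1" "\<delta> \<le> d2" using d1 d2 by (auto simp: \<delta>_def)
      have "eventually (\<lambda>r. r \<in> {0<..<1::real}) (at_left 1)"
        by (auto simp: eventually_at_left_field intro!: exI[of _ 0])
      moreover have "eventually (\<lambda>r. approach_rate \<phi> p r < \<delta> / (2 * c)) (at_left 1)"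
        using \<delta>(1) c by (intro order_tendstoD(2)[OF approach_rate_tendsto_0[OF assms(1) p]]) auto
      moreover have "eventually (\<lambda>r. radial_majorant (\<phi> r) (\<delta> / 2) < ennreal (\<eta> / (m + 1))) (at_left 1)"
        using \<delta>(1,2) \<eta> m(1) by (intro order_tendstoD(2)[OF \<phi>(3)]) auto
      moreover have "eventually (\<lambda>r. dist (LINT t|circle. \<phi> r t) 1 < \<eta> / (norm (f x) + 1)) (at_left 1)"
        using \<eta> by (intro tendstoD[OF \<phi>(2)] divide_pos_pos) (auto intro: add_nonneg_pos)
      ultimately show ?thesis
      proof eventually_elim
        case (elim r)
        have gL: "\<phi> r \<in> circle_Lp \<infinity>" using elim(1) by (intro \<phi>(1)) auto
        note g = circle_LpD[OF gL]
        show ?case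
        proof (rule SUP_least)
          fix \<theta> assume "\<theta> \<in> {\<theta>. \<bar>\<theta>\<bar> < c * approach_rate \<phi> p r}"
          then have \<theta>: "\<bar>\<theta>\<bar> < c * approach_rate \<phi> p r" by simp
          define N where "N = enn2real (circle_norm (conj_exponent p) (\<phi> r))"
          have rate: "approach_rate \<phi> p r = N powr (- p)" by (simp add: approach_rate_def N_def)
          \<comment> \<open>For \<open>N = 0\<close> the rate is \<open>0 powr (- p) = 0\<close> and no \<open>\<theta>\<close> is admissible.\<close>
          have "N \<noteq> 0" using \<theta> by (auto simp: rate)
          then have N: "N > 0" by (simp add: N_def order_less_le)
          define a where "a = c * approach_rate \<phi> p r"
          have a: "\<bar>\<theta>\<bar> < a" "0 < a" "2 * a \<le> \<delta>"
            using \<theta> elim(2) c by (auto simp: a_def field_simps)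
          have Na: "N powr p * a = c" using N by (simp add: a_def rate powr_minus)
          have "(\<integral>\<^sup>+ t. ennreal (norm (\<phi> r (x + \<theta> - t)) * norm (f t - f x)) \<partial>circle)
            \<le> ennreal \<eta> + ennreal (\<eta> powr (1 - p) * N powr p) * ennreal (\<epsilon> * (2 * a))
              + ennreal (8 * \<epsilon>) * (\<integral>\<^sup>+ u. radial_majorant (\<phi> r) u \<partial>circle)
              + radial_majorant (\<phi> r) (\<delta> / 2) * (\<integral>\<^sup>+ t. ennreal (norm (f t - f x)) \<partial>circle)"
            using a \<delta> \<epsilon>(1) small_p small_1
            by (intro kernel_estimate[OF p \<eta> g(1,3) circle_LpD(1,3)[OF f] N_def N]) auto
          also have "\<dots> \<le> ennreal \<eta> + ennreal \<eta> + ennreal \<eta> + ennreal \<eta>"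
          proof (intro add_mono order_refl)
            have "\<eta> powr (1 - p) * N powr p * (\<epsilon> * (2 * a)) = K * \<epsilon>"
              unfolding K_def Na[symmetric] by simp
            then have "ennreal (\<eta> powr (1 - p) * N powr p * (\<epsilon> * (2 * a))) = ennreal (K * \<epsilon>)"
              by (simp only:)
            then show "ennreal (\<eta> powr (1 - p) * N powr p) * ennreal (\<epsilon> * (2 * a)) \<le> ennreal \<eta>"
              using \<epsilon>(2) by (subst ennreal_mult'[symmetric]) (simp_all only: ennreal_leI mult_nonneg_nonneg powr_ge_zero)
            have "ennreal (8 * \<epsilon>) * (\<integral>\<^sup>+ u. radial_majorant (\<phi> r) u \<partial>circle) \<le> ennreal (8 * \<epsilon>) * ennreal C"
              using elim(1) by (intro mult_left_mono majorant) auto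
            also have "\<dots> \<le> ennreal \<eta>"
              using \<epsilon> C(1) by (simp add: ennreal_mult'[symmetric] ennreal_leI)
            finally show "ennreal (8 * \<epsilon>) * (\<integral>\<^sup>+ u. radial_majorant (\<phi> r) u \<partial>circle) \<le> ennreal \<eta>" .
            have "radial_majorant (\<phi> r) (\<delta> / 2) * (\<integral>\<^sup>+ t. ennreal (norm (f t - f x)) \<partial>circle)
                \<le> ennreal (\<eta> / (m + 1)) * ennreal m"
              unfolding m(2) using elim(3) by (intro mult_right_mono) auto
            also have "\<dots> \<le> ennreal \<eta>"
            proof -
              have "\<eta> / (m + 1) * m \<le> \<eta>"
                using m(1) \<eta> by (simp add: pos_divide_le_eq distrib_left)
              then show ?thesis
                using m(1) by (simp add: ennreal_mult''[symmetric] ennreal_leI)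
            qed
            finally show "radial_majorant (\<phi> r) (\<delta> / 2) * (\<integral>\<^sup>+ t. ennreal (norm (f t - f x)) \<partial>circle) \<le> ennreal \<eta>" .
          qed
          finally have 1: "(\<integral>\<^sup>+ t. ennreal (norm (\<phi> r (x + \<theta> - t)) * norm (f t - f x)) \<partial>circle)
              \<le> ennreal \<eta> + ennreal \<eta> + ennreal \<eta> + ennreal \<eta>" .
          have "norm ((LINT t|circle. \<phi> r t) - 1) * norm (f x) \<le> \<eta> / (norm (f x) + 1) * norm (f x)"
            using elim(4) by (intro mult_right_mono) (auto simp: dist_norm)
          also have "\<dots> \<le> \<eta>"
            using \<eta> by (simp add: divide_le_eq add_nonneg_pos mult_left_mono)
          finally have 2: "ennreal (norm ((LINT t|circle. \<phi> r t) - 1) * norm (f x)) \<le> ennreal \<eta>"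
            by (rule ennreal_leI)
          have "ennreal (norm (kernel_op \<phi> r (x + \<theta>) f - f x))
              \<le> (ennreal \<eta> + ennreal \<eta> + ennreal \<eta> + ennreal \<eta>) + ennreal \<eta>"
            by (rule order_trans[OF norm_kernel_op_diff_le[of \<phi> r f "x + \<theta>", OF gL fint] add_mono[OF 1 2]])
          also have "\<dots> = ennreal e"
            using \<eta> by (simp add: ennreal_plus[symmetric] \<eta>_def del: ennreal_plus)
          finally show "ennreal (norm (kernel_op \<phi> r (x + \<theta>) f - f x)) \<le> ennreal e" .
        qed
      qed
    qed
    show ?case
    proof (rule order_tendstoI)
      fix z :: ennreal assume "0 < z"
      then obtain e :: real where e: "0 < e" "ennreal e < z"
      proof -
        obtain y where "0 < y" "y < z" using dense \<open>0 < z\<close> by blast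
        then show thesis using that[of "enn2real y"] by (cases y) (auto simp: top_unique)
      qed
      show "eventually (\<lambda>r. ?S r < z) (at_left 1)"
        using main[OF e(1)] by eventually_elim (use e(2) in simp)
    qed simp
  qed
qed

end
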